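(* Let $k\ge2$ be an integer, $\lambda\ge0$, $0\le p\le k-1$ an integer, $t\in[-1,1]$ and $0\le r<1$. Then $$\phi_r\left(w_{\lambda-\frac12}^{(k),1};t,\cos\tfrac{p\pi}{k}\right)=\sum_{n=0}^\infty\frac{p_n\big(w_{\lambda-\frac12}^{(k),1};t\big)\,p_n\big(w_{\lambda-\frac12}^{(k),1};\cos\frac{p\pi}{k}\big)}{h_n\big(w_{\lambda-\frac12}^{(k),1}\big)}r^n$$ $$=\frac{(1-r)\left((1+r)^2-2r\left(\cos(\frac{p\pi}{k})+t\right)\right)}{\left((1+r^2)\left(1-4r\cos(\frac{p\pi}{k})t+r^2\right)+4r^2\left(t^2-\sin^2(\frac{p\pi}{k})\right)\right)\left(1-2(-1)^pr^kT_k(t)+r^{2k}\right)^\lambda}.$$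
   Context: $T_k$ and $U_{k-1}$ are the Chebyshev polynomials of the first and second kind: $T_k(\cos\theta)=\cos k\theta$, $U_{k-1}(\cos\theta)=\sin(k\theta)/\sin\theta$. The weight function is $$w_{\lambda-\frac12}^{(k),1}(t)=(1+t)\,|U_{k-1}(t)|^{2\lambda}(1-t^2)^{\lambda-\frac12},\qquad -1<t<1.$$ For a nonnegative weight function $w$ on $[-1,1]$ let $c_w=1/\int_{-1}^1w(x)\,dx$; $p_n(w;\cdot)$ denotes an orthogonal polynomial of degree $n$ with respect to $w$, with $c_w\int_{-1}^1p_n(w;x)p_m(w;x)w(x)\,dx=h_n(w)\delta_{n,m}$. The Poisson kernel is $\phi_r(w;x,y)=\sum_{n=0}^\infty\frac{p_n(w;x)p_n(w;y)}{h_n(w)}r^n$, $0\le r<1$ (independent of the normalization of the $p_n$). *)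

theory Defs
  imports "HOL-Analysis.Analysis" "HOL-Computational_Algebra.Polynomial"
begin

fun cheb_T :: "nat \<Rightarrow> real poly" where
  "cheb_T 0 = 1"
| "cheb_T (Suc 0) = [:0, 1:]"
| "cheb_T (Suc (Suc n)) = [:0, 2:] * cheb_T (Suc n) - cheb_T n"

fun cheb_U :: "nat \<Rightarrow> real poly" where
  "cheb_U 0 = 1"
| "cheb_U (Suc 0) = [:0, 2:]"
| "cheb_U (Suc (Suc n)) = [:0, 2:] * cheb_U (Suc n) - cheb_U n"

text \<open>The trigonometric identities which characterize the Chebyshev polynomials.\<close>

lemma cheb_T_cos: "poly (cheb_T n) (cos \<theta>) = cos (real n * \<theta>)"
proof (induction n rule: cheb_T.induct)
  case (3 n)
  have "cos (real (Suc (Suc n)) * \<theta>) + cos (real n * \<theta>) = 2 * cos \<theta> * cos (real (Suc n) * \<theta>)"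
    using cos_add[of "real (Suc n) * \<theta>" \<theta>] cos_diff[of "real (Suc n) * \<theta>" \<theta>]
    by (simp add: algebra_simps)
  then show ?case using 3 by simp
qed simp_all

lemma cheb_U_cos: "poly (cheb_U n) (cos \<theta>) * sin \<theta> = sin (real (n + 1) * \<theta>)"
proof (induction n rule: cheb_U.induct)
  case 2
  show ?case using sin_double[of \<theta>] by simp
next
  case (3 n)
  have "sin (real (Suc (Suc n) + 1) * \<theta>) + sin (real (n + 1) * \<theta>)
      = 2 * cos \<theta> * sin (real (Suc n + 1) * \<theta>)"
    using sin_add[of "real (Suc n + 1) * \<theta>" \<theta>] sin_diff[of "real (Suc n + 1) * \<theta>" \<theta>]
    by (simp add: algebra_simps)
  moreover have "poly (cheb_U (Suc (Suc n))) (cos \<theta>) * sin \<theta>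
      = 2 * cos \<theta> * (poly (cheb_U (Suc n)) (cos \<theta>) * sin \<theta>) - poly (cheb_U n) (cos \<theta>) * sin \<theta>"
    by (simp add: algebra_simps)
  ultimately show ?case using 3 by simp
qed simp

text \<open>The weight $w_{\lambda-1/2}^{(k),1}$, only ever used on $[-1,1]$ and under the integral
  sign.  For $\lambda = 0$ the convention \<^term>\<open>0 powr 0 = (0::real)\<close> changes its value at the
  finitely many zeros of $U_{k-1}$ only, a null set.\<close>

definition sieved_weight :: "nat \<Rightarrow> real \<Rightarrow> real \<Rightarrow> real" where
  "sieved_weight k l t =
     (1 + t) * \<bar>poly (cheb_U (k - 1)) t\<bar> powr (2 * l) * (1 - t\<^sup>2) powr (l - 1 / 2)"

definition weight_const :: "(real \<Rightarrow> real) \<Rightarrow> real" where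
  "weight_const w = 1 / (LBINT x:{-1..1}. w x)"

definition weight_inner :: "(real \<Rightarrow> real) \<Rightarrow> real poly \<Rightarrow> real poly \<Rightarrow> real" where
  "weight_inner w p q = weight_const w * (LBINT x:{-1..1}. poly p x * poly q x * w x)"

text \<open>The normalization of the $p_n$ is left arbitrary.  The zero polynomial has degree 0 in the
  library and has to be excluded separately.\<close>

definition orthogonal_polys :: "(real \<Rightarrow> real) \<Rightarrow> (nat \<Rightarrow> real poly) \<Rightarrow> (nat \<Rightarrow> real) \<Rightarrow> bool" where
  "orthogonal_polys w P h \<longleftrightarrow>
     (\<forall>n. P n \<noteq> 0 \<and> degree (P n) = n) \<and>
     (\<forall>n m. weight_inner w (P n) (P m) = (if n = m then h n else 0))"

definition poisson_kernel ::
    "(nat \<Rightarrow> real poly) \<Rightarrow> (nat \<Rightarrow> real) \<Rightarrow> real \<Rightarrow> real \<Rightarrow> real \<Rightarrow> real" where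
  "poisson_kernel P h r x y = (\<Sum>n. poly (P n) x * poly (P n) y / h n * r ^ n)"

end

theory Submission
  imports Defs
begin

text \<open>
  Put $t = \cos\theta$, $y = \cos\varphi$ with $\varphi = p\pi/k$. The weight becomes
  $2\cos^2(\theta/2)\,|\sin k\theta|^{2\lambda}\,d\theta$, so after multiplication by $\cos(\theta/2)$
  orthogonality is a statement about the functions $\cos((n+\frac12)\theta)$. Write $n = ak+b$ with
  $0 \le b < k$. The orthogonal polynomials are, up to normalization,
  $$Q_n(\cos\theta)\cos\tfrac\theta2
    = \sum_{i\le a} \frac{(\lambda+1)_i}{i!}\frac{(\lambda)_{a-i}}{(a-i)!}
      \cos\big((n-2k(a-i)+\tfrac12)\theta\big),$$
  whose coefficients are those of the degree $a$ polynomial orthogonal on the unit circle with respect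
  to $|1-u|^{2\lambda}$. At $y$ all cosines in the sum agree, hence
  $Q_n(y)/\|Q_n\|^2 = \cos((n+\frac12)\varphi)/\cos(\varphi/2)$. On the other hand
  $Q_n = \sum_m C_m^\lambda(\cos k\theta)\,V_{n-km}$ with the Chebyshev polynomials $V_n$ of the third
  kind, so the Poisson kernel is a product of the Gegenbauer generating function at
  $(-1)^p r^k$ and of the Poisson kernel for $\lambda = 0$.
\<close>

section \<open>Szego polynomials of the circular Jacobi weight\<close>

text \<open>With \<open>u = exp(2ikx)\<close> one has \<open>|1-u|^2 = 4 sin^2 kx\<close>. So the
  cosine moments of \<open>|sin kx|^(2l)\<close> at the frequencies \<open>2kn\<close> are, up to
  one constant, the circle moments, and the symmetries of the weight kill all other frequencies.
  Pairing \<open>cos((i+1/2)x)\<close> with \<open>cos((j+1/2)x)\<close> produces two chains of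
  frequencies, starting from \<open>i-j\<close> and \<open>i+j+1\<close>. One circle polynomial has
  to annihilate both. The step \<open>2k\<close> in \<open>Q_n\<close> achieves this: the exponents
  that occur all lie in \<open>0 <= x < a\<close>, except \<open>x = a\<close> in the difference
  chain at \<open>j = n\<close>.

  The closed form rests on a coincidence. The sum of the coefficients and the squared norm of the
  circle polynomial are both \<open>(2l+1)_a / a!\<close>, so the value at \<open>y\<close> cancels
  against the norm. What is left is a Cauchy product because \<open>cos((n+1/2)phi)\<close> equals
  \<open>(-1)^(pm) cos((n-km+1/2)phi)\<close> for \<open>phi = p pi/k\<close>.\<close>

definition rise :: "real \<Rightarrow> nat \<Rightarrow> real" where
  "rise l j = pochhammer l j / fact j"

definition szego_coeff :: "real \<Rightarrow> nat \<Rightarrow> nat \<Rightarrow> real" where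
  "szego_coeff l a i = rise (l + 1) i * rise l (a - i)"

text \<open>The Fourier coefficients of the weight $|1-u|^{2l}$ on the unit circle, normalized at $0$.
  The reciprocal gamma function gives the correct zeros when $l$ is an integer.\<close>

definition circle_moment :: "real \<Rightarrow> int \<Rightarrow> real" where
  "circle_moment l n =
     (-1) powi n * (Gamma (l + 1))\<^sup>2 * rGamma (l + 1 + of_int n) * rGamma (l + 1 - of_int n)"

lemma rise_0 [simp]: "rise l 0 = 1"
  by (simp add: rise_def)

lemma rise_Suc: "(real j + 1) * rise l (Suc j) = (l + real j) * rise l j"
proof -
  have "rise l (Suc j) = rise l j * (l + real j) / (real j + 1)"
    by (simp add: rise_def pochhammer_Suc add.commute)
  then show ?thesis by simp
qed

lemma rise_nonneg: "l \<ge> 0 \<Longrightarrow> rise l j \<ge> 0"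
  by (cases "l = 0") (auto simp: rise_def pochhammer_0_left pochhammer_pos less_imp_le)

lemma rise_pos: "l > 0 \<Longrightarrow> rise l j > 0"
  by (simp add: rise_def pochhammer_pos)

lemma rise_plus_one: "l * rise (l + 1) j = (l + real j) * rise l j"
  using pochhammer_absorb_comp[of l]
  by (simp add: rise_def pochhammer_rec[symmetric] pochhammer_Suc divide_simps mult.commute)

text \<open>The \<open>rise l m\<close> are the Taylor coefficients of \<open>(1-s)^(-l)\<close>;
  multiplication by \<open>1/(1-s)\<close> forms partial sums and raises the exponent. This later
  turns Gegenbauer coefficients into Szego coefficients.\<close>

lemma sum_rise: "(\<Sum>m\<le>a. rise l m) = rise (l + 1) a"
proof (induction a)
  case (Suc a)
  have "(real a + 1) * (rise (l + 1) a + rise l (Suc a)) = (real a + 1) * rise (l + 1) (Suc a)"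
    using rise_Suc[of a l] rise_Suc[of a "l + 1"] rise_plus_one[of l a] by (simp add: algebra_simps)
  then have "rise (l + 1) a + rise l (Suc a) = rise (l + 1) (Suc a)"
    by (subst (asm) mult_left_cancel) auto
  then show ?case using Suc by simp
qed simp

text \<open>Chu-Vandermonde: compare coefficients in
  \<open>(1-s)^(-l) (1-s)^(-m) = (1-s)^(-l-m)\<close>.\<close>

lemma sum_rise_mult: "(\<Sum>i\<le>a. rise l i * rise m (a - i)) = rise (l + m) a"
proof -
  have "rise (l + m) a = (\<Sum>i\<le>a. real (a choose i) * pochhammer l i * pochhammer m (a - i) / fact a)"
    by (simp add: rise_def pochhammer_binomial_sum sum_divide_distrib)
  also have "\<dots> = (\<Sum>i\<le>a. rise l i * rise m (a - i))"
    by (intro sum.cong) (auto simp: rise_def binomial_fact)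
  finally show ?thesis by simp
qed

text \<open>The value of the Szego polynomial at \<open>u = 1\<close>, which is what remains at the
  nodes \<open>cos(p pi/k)\<close>.\<close>

lemma sum_szego_coeff: "(\<Sum>i\<le>a. szego_coeff l a i) = rise (2 * l + 1) a"
  using sum_rise_mult[of "l + 1" l a] by (simp add: szego_coeff_def algebra_simps)

text \<open>With $S_a(u) = \sum_i s_{a,i} u^i$ for the coefficients above, this is the Szego recurrence
  $(a+1)S_{a+1} = (a+1+l)\,u S_a + l\,S_a^*$.\<close>

lemma szego_coeff_Suc:
  assumes "i \<le> Suc a" "l \<ge> 0"
  shows "(real a + 1) * szego_coeff l (Suc a) i =
    (real a + 1 + l) * (if i = 0 then 0 else szego_coeff l a (i - 1)) +
    l * (if i \<le> a then szego_coeff l a (a - i) else 0)"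
proof -
  \<comment> \<open>At either end one of the two terms on the right is absent. In the interior
    \<open>j = i - 1\<close> and \<open>m = a - i\<close>.\<close>
  consider "i = 0" | "i = Suc a" | j m where "i = Suc j" "a = Suc (j + m)"
    using assms by (metis le_Suc_eq le_add_diff_inverse less_eq_Suc_le not_less_eq_eq old.nat.exhaust add_Suc)
  then show ?thesis
  proof cases
    case 1
    then show ?thesis
      using rise_Suc[of a l] rise_plus_one[of l a] by (simp add: szego_coeff_def)
  next
    case 2
    then show ?thesis
      using rise_Suc[of a "l + 1"] by (simp add: szego_coeff_def algebra_simps)
  next
    case 3
    define A where "A = rise l (Suc j)"
    have m: "(real m + 1) * rise l (Suc m) = l * rise (l + 1) m"
      using rise_Suc[of m l] rise_plus_one[of l m] by simp
    have j: "(real j + 1) * rise l (Suc j) = l * rise (l + 1) j"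
      using rise_Suc[of j l] rise_plus_one[of l j] by simp
    have j': "(real j + 1) * rise (l + 1) (Suc j) = (l + 1 + j) * rise (l + 1) j"
      using rise_Suc[of j "l + 1"] by simp
    have "(real j + 1) * ((real a + 1) * (rise (l + 1) (Suc j) * rise l (Suc m)))
        = (real a + 1) * ((l + 1 + j) * rise (l + 1) j * rise l (Suc m))"
      unfolding j'[symmetric] by (simp add: mult_ac)
    \<comment> \<open>This is \<open>(a+1)(l+1+j) = (j+1)(a+1+l) + (m+1)l\<close>, valid because
      \<open>a = j+m+1\<close>.\<close>
    also have "\<dots> = (real j + 1) * ((real a + 1 + l) * (rise (l + 1) j * rise l (Suc m)))
          + ((real m + 1) * rise l (Suc m)) * (l * rise (l + 1) j)"
      using 3 by (simp add: algebra_simps)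
    also have "\<dots> = (real j + 1) * ((real a + 1 + l) * (rise (l + 1) j * rise l (Suc m))
          + (l * rise (l + 1) m) * rise l (Suc j))"
      unfolding m j[symmetric] by (simp add: algebra_simps)
    finally have "(real j + 1) * ((real a + 1) * (rise (l + 1) (Suc j) * rise l (Suc m)))
        = (real j + 1) * ((real a + 1 + l) * (rise (l + 1) j * rise l (Suc m))
          + (l * rise (l + 1) m) * rise l (Suc j))" .
    then have "(real a + 1) * (rise (l + 1) (Suc j) * rise l (Suc m))
        = (real a + 1 + l) * (rise (l + 1) j * rise l (Suc m)) + l * rise (l + 1) m * rise l (Suc j)"
      by (subst (asm) mult_left_cancel) auto
    then show ?thesis using 3 by (simp add: szego_coeff_def algebra_simps)
  qed
qed

section \<open>Circle moments and orthogonality of the Szego polynomials\<close>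

lemma circle_moment_minus: "circle_moment l (- n) = circle_moment l n"
  by (simp add: circle_moment_def power_int_minus_one_minus)

lemma circle_moment_0:
  assumes "l \<ge> 0"
  shows "circle_moment l 0 = 1"
proof -
  have "Gamma (l + 1) \<noteq> 0"
    using assms Gamma_real_pos[of "l + 1"] by linarith
  then show ?thesis
    by (simp add: circle_moment_def rGamma_inverse_Gamma power2_eq_square flip: divide_inverse)
qed

text \<open>\<open>rGamma z = z * rGamma (z + 1)\<close> has no exceptional points, so the
  recurrence holds for every integer. The moments of the sine weight satisfy the same one.\<close>

lemma circle_moment_rec:
  "(l + of_int n) * circle_moment l n = (of_int n - 1 - l) * circle_moment l (n - 1)"
proof -
  define e A B where "e = (-1 :: real) powi (n - 1) * (Gamma (l + 1))\<^sup>2"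
    and "A = rGamma (l + 1 + of_int n)" and "B = rGamma (l + 1 + 1 - of_int n)"
  have e: "(-1 :: real) powi n * (Gamma (l + 1))\<^sup>2 = - e"
    by (simp add: power_int_diff e_def)
  have "rGamma (l + of_int n) = (l + of_int n) * A"
    using rGamma_plus1[of "l + of_int n"] by (simp add: A_def algebra_simps)
  then have 1: "circle_moment l (n - 1) = e * ((l + of_int n) * A) * B"
    by (simp add: circle_moment_def e_def B_def algebra_simps)
  have "rGamma (l + 1 - of_int n) = (l + 1 - of_int n) * B"
    using rGamma_plus1[of "l + 1 - of_int n"] by (simp add: B_def algebra_simps)
  then have 2: "circle_moment l n = - e * A * ((l + 1 - of_int n) * B)"
    unfolding circle_moment_def e A_def by simp
  show ?thesis unfolding 1 2 by (simp add: algebra_simps)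
qed

text \<open>The Szego recurrence integrated against \<open>u^(-x)\<close>: the factor
  \<open>u\<close> replaces \<open>x\<close> by \<open>x - 1\<close>, and reversal of the
  coefficients replaces \<open>x\<close> by \<open>a - x\<close>, since the moments are
  even.\<close>

lemma szego_moment_Suc:
  assumes "l \<ge> 0"
  shows "(real a + 1) * (\<Sum>i\<le>Suc a. szego_coeff l (Suc a) i * circle_moment l (int i - x)) =
    (real a + 1 + l) * (\<Sum>i\<le>a. szego_coeff l a i * circle_moment l (int i - (x - 1))) +
    l * (\<Sum>i\<le>a. szego_coeff l a i * circle_moment l (int i - (int a - x)))"
proof -
  have "(real a + 1) * (\<Sum>i\<le>Suc a. szego_coeff l (Suc a) i * circle_moment l (int i - x)) =
    (\<Sum>i\<le>Suc a. (real a + 1 + l) * ((if i = 0 then 0 else szego_coeff l a (i - 1)) * circle_moment l (int i - x)) +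
      l * ((if i \<le> a then szego_coeff l a (a - i) else 0) * circle_moment l (int i - x)))"
    unfolding sum_distrib_left
  proof (intro sum.cong refl)
    fix i assume "i \<in> {..Suc a}"
    then show "(real a + 1) * (szego_coeff l (Suc a) i * circle_moment l (int i - x)) =
      (real a + 1 + l) * ((if i = 0 then 0 else szego_coeff l a (i - 1)) * circle_moment l (int i - x)) +
      l * ((if i \<le> a then szego_coeff l a (a - i) else 0) * circle_moment l (int i - x))"
      using szego_coeff_Suc[of i a l] assms by (auto simp only: mult.assoc[symmetric] distrib_right atMost_iff)
  qed
  also have "\<dots> = (real a + 1 + l) *
      (\<Sum>i\<le>Suc a. (if i = 0 then 0 else szego_coeff l a (i - 1)) * circle_moment l (int i - x)) +
      l * (\<Sum>i\<le>Suc a. (if i \<le> a then szego_coeff l a (a - i) else 0) * circle_moment l (int i - x))"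
    by (simp only: sum.distrib sum_distrib_left)
  also have "(\<Sum>i\<le>Suc a. (if i = 0 then 0 else szego_coeff l a (i - 1)) * circle_moment l (int i - x)) =
     (\<Sum>i\<le>a. szego_coeff l a i * circle_moment l (int i - (x - 1)))"
    unfolding sum.atMost_Suc_shift by (simp add: algebra_simps)
  also have "(\<Sum>i\<le>Suc a. (if i \<le> a then szego_coeff l a (a - i) else 0) * circle_moment l (int i - x)) =
     (\<Sum>i\<le>a. szego_coeff l a (a - i) * circle_moment l (int i - x))"
    by simp
  also have "\<dots> = (\<Sum>i\<le>a. szego_coeff l a i * circle_moment l (int a - int i - x))"
    by (rule sum.reindex_bij_witness[of _ "\<lambda>i. a - i" "\<lambda>i. a - i"]) (auto simp: of_nat_diff)
  also have "\<dots> = (\<Sum>i\<le>a. szego_coeff l a i * circle_moment l (int i - (int a - x)))"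
  proof (intro sum.cong refl)
    fix i
    have "int a - int i - x = - (int i - (int a - x))" by simp
    then show "szego_coeff l a i * circle_moment l (int a - int i - x) =
        szego_coeff l a i * circle_moment l (int i - (int a - x))"
      by (simp only: circle_moment_minus)
  qed
  finally show ?thesis .
qed

text \<open>A closed form for every integer $x$ is needed for the induction, because the recurrence at $x = 0$
  involves the value at $x = -1$.\<close>

lemma szego_moment:
  assumes l: "l \<ge> 0"
  shows "(\<Sum>i\<le>a. szego_coeff l a i * circle_moment l (int i - x)) =
    (-1) ^ a * rise (2 * l + 1) a * (Gamma (l + 1))\<^sup>2 * (-1) powi x * (\<Prod>q<a. of_int x - real q) *
    rGamma (l + 1 + of_int x) * rGamma (l + 1 + real a - of_int x)"
proof (induction a arbitrary: x)
  case 0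
  show ?case using circle_moment_minus[of l x] by (simp add: szego_coeff_def circle_moment_def)
next
  case (Suc a)
  define C where "C = (-1) ^ a * rise (2 * l + 1) a * (Gamma (l + 1))\<^sup>2 * (-1) powi x"
  define F where "F = (\<Prod>q<a. of_int x - 1 - real q)"
  define A where "A = rGamma (l + 1 + of_int x)"
  define B where "B = rGamma (l + 1 + real (Suc a) - of_int x)"
  have x1: "(-1 :: real) powi (x - 1) = - ((-1) powi x)"
    by (simp add: power_int_diff)
  have xa: "(-1 :: real) powi (int a - x) = (-1) ^ a * (-1) powi x"
    unfolding diff_conv_add_uminus by (subst power_int_add) (simp_all add: power_int_minus_one_minus)
  have "(\<Prod>q<a. of_int (int a - x) - real q) = (\<Prod>q<a. - (of_int x - 1 - real q))"
    by (rule prod.reindex_bij_witness[of _ "\<lambda>i. a - 1 - i" "\<lambda>i. a - 1 - i"]) (auto simp: of_nat_diff)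
  also have "\<dots> = (-1) ^ a * F"
    by (simp add: F_def prod_uminus del: minus_diff_eq)
  finally have Fa: "(\<Prod>q<a. of_int (int a - x) - real q) = (-1) ^ a * F" .
  have FS: "(\<Prod>q<Suc a. of_int x - real q) = of_int x * F"
    unfolding prod.lessThan_Suc_shift by (simp add: F_def algebra_simps)
  have A': "rGamma (l + of_int x) = (l + of_int x) * A"
    using rGamma_plus1[of "l + of_int x"] by (simp add: A_def algebra_simps)
  have B': "rGamma (l + 1 + real a - of_int x) = (l + 1 + real a - of_int x) * B"
    using rGamma_plus1[of "l + 1 + real a - of_int x"] by (simp add: B_def algebra_simps)
  have 1: "(\<Sum>i\<le>a. szego_coeff l a i * circle_moment l (int i - (x - 1))) =
      - C * F * (l + of_int x) * A * B"
    unfolding Suc.IH x1 using A' by (simp add: C_def F_def B_def algebra_simps)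
  have 2: "(\<Sum>i\<le>a. szego_coeff l a i * circle_moment l (int i - (int a - x))) =
      C * F * A * ((l + 1 + real a - of_int x) * B)"
    unfolding Suc.IH xa Fa B'[symmetric] by (simp add: C_def A_def algebra_simps)
  have "(real a + 1) * (\<Sum>i\<le>Suc a. szego_coeff l (Suc a) i * circle_moment l (int i - x)) =
     C * F * A * B * (- (real a + 1 + l) * (l + of_int x) + l * (l + 1 + real a - of_int x))"
    unfolding szego_moment_Suc[OF l] 1 2 by (simp add: algebra_simps)
  \<comment> \<open>The bracket collapses to \<open>-(a+1+2l) x\<close>, which supplies both the new
    factor \<open>x\<close> of the product and the factor that advances
    \<open>rise (2 * l + 1)\<close>.\<close>
  also have "\<dots> = - (real a + 1 + 2 * l) * C * (of_int x * F) * A * B"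
    by (simp add: algebra_simps)
  also have "\<dots> = - ((-1) ^ a) * ((2 * l + 1 + real a) * rise (2 * l + 1) a) *
      (Gamma (l + 1))\<^sup>2 * (-1) powi x * (of_int x * F) * A * B"
    by (simp add: C_def algebra_simps)
  also have "\<dots> = (real a + 1) * ((-1) ^ Suc a * rise (2 * l + 1) (Suc a) *
      (Gamma (l + 1))\<^sup>2 * (-1) powi x * (of_int x * F) * A * B)"
    unfolding rise_Suc[symmetric] by (simp add: algebra_simps)
  finally have "(\<Sum>i\<le>Suc a. szego_coeff l (Suc a) i * circle_moment l (int i - x)) =
      (-1) ^ Suc a * rise (2 * l + 1) (Suc a) *
      (Gamma (l + 1))\<^sup>2 * (-1) powi x * (of_int x * F) * A * B"
    by (subst (asm) mult_left_cancel) auto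
  then show ?case unfolding FS A_def B_def .
qed

text \<open>The factor \<open>q = x\<close> of the product in the closed form vanishes. This is
  orthogonality to \<open>1, u, ..., u^(a-1)\<close>.\<close>

lemma szego_moment_eq_0:
  assumes "l \<ge> 0" "0 \<le> x" "x < int a"
  shows "(\<Sum>i\<le>a. szego_coeff l a i * circle_moment l (int i - x)) = 0"
proof -
  have "(\<Prod>q<a. of_int x - real q) = 0"
    using assms by (auto intro!: bexI[of _ "nat x"])
  then show ?thesis using szego_moment[OF assms(1)] by simp
qed

text \<open>\<open>rise (l + 1) a\<close> is the leading coefficient, so by orthogonality the left
  side is the squared norm of the Szego polynomial. It agrees with
  \<open>sum_szego_coeff\<close>.\<close>

lemma szego_moment_top:
  assumes "l \<ge> 0"
  shows "rise (l + 1) a * (\<Sum>i\<le>a. szego_coeff l a i * circle_moment l (int i - int a)) =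
    rise (2 * l + 1) a"
proof -
  have "(\<Prod>q<a. real a - real q) = (\<Prod>q<a. real (Suc q))"
    by (rule prod.reindex_bij_witness[of _ "\<lambda>i. a - 1 - i" "\<lambda>i. a - 1 - i"]) (auto simp: of_nat_diff)
  then have 1: "(\<Prod>q<a. real a - real q) = fact a"
    by (simp add: fact_prod_Suc atLeast0LessThan)
  have g: "Gamma (l + 1) > 0" "Gamma (l + 1 + real a) > 0"
    using assms by (auto intro!: Gamma_real_pos)
  have 2: "pochhammer (l + 1) a = Gamma (l + 1 + real a) / Gamma (l + 1)"
    using assms by (intro pochhammer_Gamma) (auto elim!: nonpos_Ints_cases)
  show ?thesis
    unfolding szego_moment[OF assms] using g 1 2
    by (simp add: rise_def rGamma_inverse_Gamma power2_eq_square field_simps power_mult_distrib[symmetric])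
qed

section \<open>Chebyshev polynomials of the third kind and the sieved polynomials\<close>

text \<open>The recurrence \<open>V_{n+1} + V_n = 2 T_{n+1}\<close> is used because bounds and the
  generating function of \<open>V\<close> then come directly from those of \<open>T\<close>.\<close>

primrec cheb_V :: "nat \<Rightarrow> real poly" where
  "cheb_V 0 = 1"
| "cheb_V (Suc n) = smult 2 (cheb_T (Suc n)) - cheb_V n"

text \<open>The extension by $V_{-1-i} = V_i$ is forced by $V_i(\cos x)\cos(x/2) = \cos((i+\frac12)x)$.\<close>

definition cheb_V_int :: "int \<Rightarrow> real poly" where
  "cheb_V_int i = cheb_V (nat (if i \<ge> 0 then i else - 1 - i))"

lemma cheb_V_cos: "poly (cheb_V n) (cos x) * cos (x / 2) = cos ((real n + 1 / 2) * x)"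
proof (induction n)
  case (Suc n)
  have "cos ((real (Suc n) + 1 / 2) * x) + cos ((real n + 1 / 2) * x) = 2 * cos (real (Suc n) * x) * cos (x / 2)"
    using cos_add[of "real (Suc n) * x" "x / 2"] cos_diff[of "real (Suc n) * x" "x / 2"]
    by (simp add: algebra_simps)
  then show ?case
    using Suc by (simp add: cheb_T_cos left_diff_distrib)
qed simp

lemma cheb_V_int_cos: "poly (cheb_V_int i) (cos x) * cos (x / 2) = cos ((of_int i + 1 / 2) * x)"
proof (cases "i \<ge> 0")
  case False
  then have "real (nat (- 1 - i)) = - 1 - of_int i"
    by simp
  then have "(real (nat (- 1 - i)) + 1 / 2) * x = - ((of_int i + 1 / 2) * x)"
    by (simp add: algebra_simps)
  then have "cos ((real (nat (- 1 - i)) + 1 / 2) * x) = cos ((of_int i + 1 / 2) * x)"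
    by (simp only: cos_minus)
  then show ?thesis using False by (simp add: cheb_V_int_def cheb_V_cos)
qed (simp add: cheb_V_int_def cheb_V_cos)

section \<open>Degrees, leading coefficients and size of the Chebyshev polynomials\<close>

lemma degree_cheb_T: "degree (cheb_T n) \<le> n"
proof (induction n rule: cheb_T.induct)
  case (3 n)
  have "degree ([:0, 2:] * cheb_T (Suc n)) \<le> Suc (Suc n)"
    using degree_mult_le[of "[:0, 2:]" "cheb_T (Suc n)"] 3(1) by simp
  then show ?case using 3(2) by (auto intro!: degree_diff_le)
qed simp_all

lemma coeff_cheb_T: "coeff (cheb_T (Suc n)) (Suc n) = 2 ^ n"
proof (induction n)
  case (Suc n)
  have "coeff (cheb_T n) (Suc (Suc n)) = 0"
    using degree_cheb_T[of n] by (intro coeff_eq_0) simp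
  then show ?case using Suc by (simp add: coeff_pCons split: nat.splits)
qed simp

lemma degree_cheb_V_le: "degree (cheb_V n) \<le> n"
proof (induction n)
  case (Suc n)
  then show ?case
    using degree_cheb_T[of "Suc n"] by (auto intro!: degree_diff_le simp del: cheb_T.simps)
qed simp

lemma coeff_cheb_V: "coeff (cheb_V n) n = 2 ^ n"
proof (cases n)
  case (Suc m)
  have "coeff (cheb_V m) (Suc m) = 0"
    using degree_cheb_V_le[of m] by (intro coeff_eq_0) simp
  then show ?thesis using Suc by (simp add: coeff_cheb_T del: cheb_T.simps)
qed simp

lemma degree_cheb_V: "degree (cheb_V n) = n"
  by (intro antisym degree_cheb_V_le le_degree) (simp add: coeff_cheb_V)

lemma cheb_V_nonzero: "cheb_V n \<noteq> 0"
  using coeff_cheb_V[of n] by auto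

text \<open>A crude linear bound is enough: it is only compared with geometric decay.\<close>

lemma abs_cheb_V_le:
  assumes "\<bar>t\<bar> \<le> 1"
  shows "\<bar>poly (cheb_V n) t\<bar> \<le> 2 * real n + 1"
proof (induction n)
  case (Suc n)
  have "poly (cheb_T (Suc n)) t = cos (real (Suc n) * arccos t)"
    using cheb_T_cos[of "Suc n" "arccos t"] assms by (simp add: cos_arccos_abs)
  then have "\<bar>poly (cheb_T (Suc n)) t\<bar> \<le> 1" by simp
  moreover have "poly (cheb_V (Suc n)) t = 2 * poly (cheb_T (Suc n)) t - poly (cheb_V n) t"
    by (simp del: cheb_T.simps)
  ultimately show ?case using Suc by (simp del: cheb_T.simps cheb_V.simps)
qed simp

text \<open>The endpoint \<open>pi\<close> is left out because identities multiplied by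
  \<open>cos (x / 2)\<close> say nothing there.\<close>

lemma poly_eqI_cos:
  fixes p q :: "real poly"
  assumes "\<And>x. 0 < x \<Longrightarrow> x < pi \<Longrightarrow> poly p (cos x) = poly q (cos x)"
  shows "p = q"
proof (rule ccontr)
  assume "p \<noteq> q"
  then have "finite {t. poly (p - q) t = 0}"
    by (intro poly_roots_finite) simp
  moreover have "{-1<..<1} \<subseteq> {t. poly (p - q) t = 0}"
  proof
    fix t :: real
    assume "t \<in> {-1<..<1}"
    then show "t \<in> {t. poly (p - q) t = 0}"
      using assms[of "arccos t"] arccos_lt_bounded[of t] by (simp add: cos_arccos)
  qed
  ultimately have "finite {-1<..<(1::real)}"
    by (rule rev_finite_subset)
  then show False using infinite_Ioo[of "-1" "1::real"] by simp
qed

text \<open>The index of \<open>V\<close> can be negative, which is why \<open>cheb_V_int\<close>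
  appears.\<close>

definition sieved_poly :: "nat \<Rightarrow> real \<Rightarrow> nat \<Rightarrow> real poly" where
  "sieved_poly k l n = (\<Sum>i\<le>n div k. smult (szego_coeff l (n div k) i)
     (cheb_V_int (int n - 2 * int k * (int (n div k) - int i))))"

text \<open>The Gegenbauer polynomial $C_m^l(\cos x)$.\<close>

definition gegenbauer_cos :: "real \<Rightarrow> nat \<Rightarrow> real \<Rightarrow> real" where
  "gegenbauer_cos l m x = (\<Sum>j\<le>m. rise l j * rise l (m - j) * cos ((2 * real j - real m) * x))"

text \<open>In the addition theorem the sine part changes sign under \<open>j -> m - j\<close>,
  while the coefficients do not, so it cancels.\<close>

lemma gegenbauer_cos_shift:
  "(\<Sum>j\<le>m. rise l j * rise l (m - j) * cos (z + (2 * real j - real m) * x)) = gegenbauer_cos l m x * cos z"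
proof -
  let ?s = "\<Sum>j\<le>m. rise l j * rise l (m - j) * sin ((2 * real j - real m) * x)"
  have "?s = (\<Sum>j\<le>m. rise l (m - j) * rise l j * sin (- ((2 * real j - real m) * x)))"
    by (rule sum.reindex_bij_witness[of _ "\<lambda>i. m - i" "\<lambda>i. m - i"]) (auto simp: of_nat_diff algebra_simps)
  also have "\<dots> = - ?s"
    unfolding sin_minus by (simp add: sum_negf mult.commute)
  finally have s: "?s = 0" by simp
  have "(\<Sum>j\<le>m. rise l j * rise l (m - j) * cos (z + (2 * real j - real m) * x)) =
    gegenbauer_cos l m x * cos z - ?s * sin z"
    unfolding cos_add gegenbauer_cos_def sum_distrib_right sum_subtractf[symmetric]
    by (intro sum.cong refl) (simp add: algebra_simps)
  then show ?thesis using s by simp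
qed

text \<open>Both sides run over the pairs with \<open>j + i \<le> a\<close>; the left side groups
  them by \<open>m = j + i\<close>.\<close>

lemma sum_triangle_swap:
  fixes f :: "nat \<Rightarrow> nat \<Rightarrow> 'a :: comm_monoid_add"
  shows "(\<Sum>m\<le>a. \<Sum>j\<le>m. f j (m - j)) = (\<Sum>i\<le>a. \<Sum>j\<le>a - i. f j i)"
proof -
  have "(\<Sum>i\<le>a. \<Sum>j\<le>a - i. f j i) = (\<Sum>(i, j)\<in>(SIGMA i:{..a}. {..a - i}). f j i)"
    by (simp add: sum.Sigma)
  also have "\<dots> = (\<Sum>(j, i)\<in>{(j, i). j + i \<le> a}. f j i)"
    by (rule sum.reindex_bij_witness[of _ "\<lambda>(i, j). (j, i)" "\<lambda>(i, j). (j, i)"]) auto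
  finally show ?thesis by (simp add: sum.triangle_reindex_eq)
qed

lemma sieved_poly_cos:
  "poly (sieved_poly k l n) (cos x) * cos (x / 2) = (\<Sum>i\<le>n div k. szego_coeff l (n div k) i *
     cos ((real n + 1 / 2 - 2 * real k * (real (n div k) - real i)) * x))"
  unfolding sieved_poly_def poly_sum sum_distrib_right poly_smult
proof (intro sum.cong refl)
  fix i
  show "szego_coeff l (n div k) i * poly (cheb_V_int (int n - 2 * int k * (int (n div k) - int i))) (cos x) * cos (x / 2) =
    szego_coeff l (n div k) i * cos ((real n + 1 / 2 - 2 * real k * (real (n div k) - real i)) * x)"
    unfolding mult.assoc cheb_V_int_cos by (simp add: algebra_simps)
qed

text \<open>The polynomial \<open>C_m^l(T_k)\<close>. Evenness of the cosine allows the absolute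
  value, which gives \<open>T\<close> a natural index.\<close>

definition sieved_gegenbauer :: "nat \<Rightarrow> real \<Rightarrow> nat \<Rightarrow> real poly" where
  "sieved_gegenbauer k l m = (\<Sum>j\<le>m. smult (rise l j * rise l (m - j)) (cheb_T (k * nat \<bar>2 * int j - int m\<bar>)))"

lemma sieved_gegenbauer_cos: "poly (sieved_gegenbauer k l m) (cos x) = gegenbauer_cos l m (real k * x)"
  unfolding sieved_gegenbauer_def gegenbauer_cos_def poly_sum
proof (intro sum.cong refl)
  fix j
  have "real (k * nat \<bar>2 * int j - int m\<bar>) * x = \<bar>2 * real j - real m\<bar> * (real k * x)"
    by simp
  moreover have "cos (\<bar>2 * real j - real m\<bar> * (real k * x)) = cos ((2 * real j - real m) * (real k * x))"
    by (cases "2 * real j - real m \<ge> 0") (simp_all only: abs_of_nonneg abs_of_neg not_le mult_minus_left cos_minus)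
  ultimately show "poly (smult (rise l j * rise l (m - j)) (cheb_T (k * nat \<bar>2 * int j - int m\<bar>))) (cos x) =
      rise l j * rise l (m - j) * cos ((2 * real j - real m) * (real k * x))"
    by (simp only: poly_smult cheb_T_cos)
qed

text \<open>The product of \<open>C_m^l(cos kx)\<close> and \<open>cos((n-km+1/2)x)\<close> has the
  frequencies \<open>n + 1/2 - 2k(m-j)\<close>. They depend on \<open>i = m - j\<close> alone, so
  summing over the free \<open>j \<le> a - i\<close> turns \<open>rise l\<close> into
  \<open>rise (l + 1)\<close>.\<close>

lemma sieved_poly_convolution:
  "sieved_poly k l n = (\<Sum>m\<le>n div k. sieved_gegenbauer k l m * cheb_V (n - k * m))"
proof (rule poly_eqI_cos)
  fix x :: real
  assume x: "0 < x" "x < pi"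
  define a where "a = n div k"
  have le: "k * m \<le> n" if "m \<le> a" for m
    using that by (metis a_def le_trans mult_le_mono2 times_div_less_eq_dividend)
  define f where "f j i = rise l j * rise l i * cos ((real n + 1 / 2 - 2 * real k * real i) * x)" for j i
  have "poly (\<Sum>m\<le>a. sieved_gegenbauer k l m * cheb_V (n - k * m)) (cos x) * cos (x / 2) =
     (\<Sum>m\<le>a. \<Sum>j\<le>m. f j (m - j))"
    unfolding poly_sum sum_distrib_right
  proof (intro sum.cong refl)
    fix m assume m: "m \<in> {..a}"
    have "poly (sieved_gegenbauer k l m * cheb_V (n - k * m)) (cos x) * cos (x / 2) =
       gegenbauer_cos l m (real k * x) * cos ((real (n - k * m) + 1 / 2) * x)"
      by (simp add: sieved_gegenbauer_cos cheb_V_cos mult.assoc)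
    also have "\<dots> = (\<Sum>j\<le>m. f j (m - j))"
      unfolding gegenbauer_cos_shift[symmetric] f_def
    proof (intro sum.cong refl)
      fix j assume j: "j \<in> {..m}"
      have nk: "real (n - k * m) = real n - real k * real m"
        using le[of m] m by (subst of_nat_diff) simp_all
      from j have "(real (n - k * m) + 1 / 2) * x + (2 * real j - real m) * (real k * x) =
         (real n + 1 / 2 - 2 * real k * real (m - j)) * x"
        unfolding nk by (simp add: of_nat_diff algebra_simps)
      then show "rise l j * rise l (m - j) * cos ((real (n - k * m) + 1 / 2) * x + (2 * real j - real m) * (real k * x)) =
          rise l j * rise l (m - j) * cos ((real n + 1 / 2 - 2 * real k * real (m - j)) * x)"
        by (simp only:)
    qed
    finally show "poly (sieved_gegenbauer k l m * cheb_V (n - k * m)) (cos x) * cos (x / 2) = (\<Sum>j\<le>m. f j (m - j))" .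
  qed
  also have "\<dots> = (\<Sum>i\<le>a. \<Sum>j\<le>a - i. f j i)"
    by (rule sum_triangle_swap)
  also have "\<dots> = (\<Sum>i\<le>a. rise (l + 1) (a - i) * (rise l i * cos ((real n + 1 / 2 - 2 * real k * real i) * x)))"
    unfolding f_def sum_rise[symmetric] by (simp add: sum_distrib_right mult.assoc)
  also have "\<dots> = (\<Sum>i\<le>a. szego_coeff l a i *
     cos ((real n + 1 / 2 - 2 * real k * (real a - real i)) * x))"
    by (rule sum.reindex_bij_witness[of _ "\<lambda>i. a - i" "\<lambda>i. a - i"]) (auto simp: of_nat_diff szego_coeff_def)
  also have "\<dots> = poly (sieved_poly k l n) (cos x) * cos (x / 2)"
    by (simp add: sieved_poly_cos a_def)
  finally show "poly (sieved_poly k l n) (cos x) =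
      poly (\<Sum>m\<le>n div k. sieved_gegenbauer k l m * cheb_V (n - k * m)) (cos x)"
    using x cos_gt_zero_pi[of "x / 2"] by (simp add: a_def)
qed

lemma coeff_sieved_poly:
  assumes "k > 0" "n \<le> i"
  shows "coeff (sieved_poly k l n) i = (if i = n then rise (l + 1) (n div k) * 2 ^ n else 0)"
proof -
  define a where "a = n div k"
  have n: "int n = int k * int a + int (n mod k)"
    by (simp add: a_def flip: of_nat_mult of_nat_add)
  have *: "coeff (cheb_V_int (int n - 2 * int k * (int a - int j))) i = 0" if "j < a" for j
  proof -
    define d where "d = int n - 2 * int k * (int a - int j)"
    have "int k * (int a - int j) > 0" "int k * int j \<ge> 0"
      using that assms by simp_all
    moreover have "int k * (int a - int j) = int k * int a - int k * int j"
      by (simp add: algebra_simps)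
    moreover have "d = int n - 2 * (int k * (int a - int j))"
      by (simp add: d_def)
    \<comment> \<open>Both bounds are needed, since a negative index \<open>d\<close> is folded to
      \<open>-1 - d\<close>. Hence only \<open>j = a\<close> reaches degree
      \<open>n\<close>.\<close>
    ultimately have "d < int n" "- 1 - d < int n"
      using n by linarith+
    then have "nat (if d \<ge> 0 then d else - 1 - d) < n"
      by auto
    then show ?thesis
      using assms by (intro coeff_eq_0) (simp add: cheb_V_int_def degree_cheb_V flip: d_def)
  qed
  have "coeff (sieved_poly k l n) i =
      (\<Sum>j\<le>a. szego_coeff l a j * coeff (cheb_V_int (int n - 2 * int k * (int a - int j))) i)"
    by (simp add: sieved_poly_def a_def coeff_sum)
  also have "\<dots> = (\<Sum>j\<in>{a}. szego_coeff l a j * coeff (cheb_V_int (int n - 2 * int k * (int a - int j))) i)"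
    using * by (intro sum.mono_neutral_right) auto
  also have "\<dots> = rise (l + 1) a * coeff (cheb_V n) i"
    by (simp add: szego_coeff_def cheb_V_int_def)
  also have "coeff (cheb_V n) i = (if i = n then 2 ^ n else 0)"
    using assms by (auto simp: coeff_cheb_V degree_cheb_V intro!: coeff_eq_0)
  finally show ?thesis by (simp add: a_def)
qed

lemma degree_sieved_poly:
  assumes "k > 0" "l \<ge> 0"
  shows "sieved_poly k l n \<noteq> 0" "degree (sieved_poly k l n) = n"
proof -
  have nz: "coeff (sieved_poly k l n) n \<noteq> 0"
    using coeff_sieved_poly[of k n n l] rise_pos[of "l + 1" "n div k"] assms by simp
  then show "sieved_poly k l n \<noteq> 0" by auto
  show "degree (sieved_poly k l n) = n"
    using nz coeff_sieved_poly[of k n] assms by (intro antisym degree_le le_degree) auto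
qed

text \<open>A span argument: successive leading terms are removed by multiples of
  \<open>V m\<close>. The degree bound is put on coefficients so that \<open>n = 0\<close> forces
  \<open>q = 0\<close>; \<open>degree q < n\<close> would exclude the zero polynomial there.\<close>

lemma poly_triangular_induct:
  fixes V :: "nat \<Rightarrow> 'a :: field poly"
  assumes V: "\<And>m. V m \<noteq> 0" "\<And>m. degree (V m) = m"
    and zero: "\<Phi> 0" and add: "\<And>p q. \<Phi> p \<Longrightarrow> \<Phi> q \<Longrightarrow> \<Phi> (p + q)"
    and smult: "\<And>c p. \<Phi> p \<Longrightarrow> \<Phi> (smult c p)"
    and base: "\<And>m. m < n \<Longrightarrow> \<Phi> (V m)" and q: "\<And>i. n \<le> i \<Longrightarrow> coeff q i = 0"
  shows "\<Phi> q"
  using base q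
proof (induction n arbitrary: q)
  case 0
  then have "q = 0" by (intro poly_eqI) simp
  then show ?case using zero by simp
next
  case (Suc n)
  define c where "c = coeff q n / coeff (V n) n"
  have nz: "coeff (V n) n \<noteq> 0"
    using V[of n] by (metis leading_coeff_0_iff)
  have "coeff (q - smult c (V n)) i = 0" if "n \<le> i" for i
  proof (cases "i = n")
    case False
    then have "coeff (V n) i = 0"
      using that V(2)[of n] by (intro coeff_eq_0) simp
    then show ?thesis using False that Suc.prems(2)[of i] by simp
  qed (use nz in \<open>simp add: c_def\<close>)
  then have "\<Phi> (q - smult c (V n))"
    using Suc by simp
  then have "\<Phi> ((q - smult c (V n)) + smult c (V n))"
    using Suc.prems(1) by (intro add smult) auto
  then show ?case by simp
qed

text \<open>\<open>P n\<close> is a scalar multiple of \<open>Q n\<close>, and the scalar cancels in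
  the kernel term. Positivity of \<open>L\<close> is replaced by
  \<open>L (Q n * Q n) \<noteq> 0\<close>: a nonzero difference \<open>D\<close> of degree
  \<open>d < n\<close> would pair nontrivially with \<open>Q d\<close>, although it is orthogonal to
  everything below degree \<open>n\<close>.\<close>

lemma orthogonal_poly_unique:
  fixes L :: "'a :: field poly \<Rightarrow> 'a"
  assumes add: "\<And>p q. L (p + q) = L p + L q" and smult: "\<And>c p. L (smult c p) = c * L p"
    and P: "\<And>n. P n \<noteq> 0" "\<And>n. degree (P n) = n"
    and PP: "\<And>n m. L (P n * P m) = (if n = m then h n else 0)"
    and Q: "\<And>n. Q n \<noteq> 0" "\<And>n. degree (Q n) = n"
    and V: "\<And>n. V n \<noteq> 0" "\<And>n. degree (V n) = n"
    and QV: "\<And>n m. m < n \<Longrightarrow> L (Q n * V m) = 0"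
    and QQ: "\<And>n. L (Q n * Q n) \<noteq> 0"
  shows "poly (P n) x * poly (P n) y / h n = poly (Q n) x * poly (Q n) y / L (Q n * Q n)"
proof -
  have L0: "L 0 = 0" using smult[of 0 0] by simp
  have P_low: "L (P n * q) = 0" if "\<And>i. n \<le> i \<Longrightarrow> coeff q i = 0" for n q
    by (rule poly_triangular_induct[where n = n and V = P and \<Phi> = "\<lambda>q. L (P n * q) = 0"])
      (use P L0 that in \<open>simp_all add: PP distrib_left add smult\<close>)
  have Q_low: "L (Q n * q) = 0" if "\<And>i. n \<le> i \<Longrightarrow> coeff q i = 0" for n q
    by (rule poly_triangular_induct[where n = n and V = V and \<Phi> = "\<lambda>q. L (Q n * q) = 0"])
      (use V L0 that in \<open>simp_all add: QV distrib_left add smult\<close>)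
  have lead: "coeff (P n) n \<noteq> 0" "coeff (Q n) n \<noteq> 0" for n
    using P[of n] Q[of n] by (metis leading_coeff_0_iff)+
  define a where "a = coeff (P n) n / coeff (Q n) n"
  have a: "a \<noteq> 0" using lead by (simp add: a_def)
  define D where "D = P n - smult a (Q n)"
  have D: "coeff D i = 0" if "n \<le> i" for i
  proof (cases "i = n")
    case False
    then show ?thesis
      using that P(2)[of n] Q(2)[of n] by (simp add: D_def coeff_eq_0)
  qed (use lead in \<open>simp add: D_def a_def\<close>)
  have D_low: "L (D * q) = 0" if "\<And>i. n \<le> i \<Longrightarrow> coeff q i = 0" for q
  proof -
    have "L (D * q) = L (P n * q) + L (smult (- a) (Q n * q))"
      unfolding add[symmetric] by (simp add: D_def algebra_simps)
    then show ?thesis using P_low Q_low that by (simp only: smult mult_zero_right add_0_left)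
  qed
  have "D = 0"
  proof (rule ccontr)
    assume nz: "D \<noteq> 0"
    define d where "d = degree D"
    have dn: "d < n"
      using D[of d] nz by (metis d_def leading_coeff_0_iff not_le)
    define b where "b = coeff D d / coeff (Q d) d"
    have b: "b \<noteq> 0" using nz lead by (simp add: b_def d_def)
    have "coeff (D - smult b (Q d)) i = 0" if "d \<le> i" for i
    proof (cases "i = d")
      case False
      then show ?thesis
        using that Q(2)[of d] by (simp add: d_def coeff_eq_0)
    qed (use lead in \<open>simp add: b_def\<close>)
    then have "L (Q d * (D - smult b (Q d))) = 0"
      by (rule Q_low)
    moreover have "L (Q d * D) = 0"
      using D_low[of "Q d"] dn Q(2)[of d] by (simp add: mult.commute coeff_eq_0)
    moreover have "L (Q d * D) = L (Q d * (D - smult b (Q d))) + b * L (Q d * Q d)"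
      unfolding smult[symmetric] add[symmetric] by (simp add: algebra_simps)
    ultimately show False using b QQ[of d] by simp
  qed
  then have Pn: "P n = smult a (Q n)" by (simp add: D_def)
  have "h n = a * (a * L (Q n * Q n))"
    using PP[of n n] unfolding Pn smult[symmetric] by simp
  then show ?thesis using a unfolding Pn by simp
qed

section \<open>Generating functions\<close>

lemma rise_sums:
  fixes s :: real
  assumes "\<bar>s\<bar> < 1"
  shows "(\<lambda>n. rise l n * s ^ n) sums (1 - s) powr (- l)"
proof -
  have "rise l n * s ^ n = (- l gchoose n) * (- s) ^ n" for n
  proof -
    have "(- l gchoose n) * (- s) ^ n = rise l n * (((- 1) * (- s)) ^ n)"
      unfolding power_mult_distrib by (simp add: gbinomial_pochhammer rise_def)
    then show ?thesis by simp
  qed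
  then show ?thesis
    using gen_binomial_real[of "- s" "- l"] assms by simp
qed

lemma rise_sums_complex:
  fixes z :: complex
  assumes "norm z < 1"
  shows "(\<lambda>n. of_real (rise l n) * z ^ n) sums (1 - z) powr (- of_real l)"
proof -
  have "of_real (rise l n) * z ^ n = (- of_real l gchoose n) * (- z) ^ n" for n
  proof -
    have "(- of_real l gchoose n) * (- z) ^ n = of_real (rise l n) * (((- 1) * (- z)) ^ n)"
      unfolding power_mult_distrib
      by (simp add: gbinomial_pochhammer rise_def pochhammer_of_real)
    then show ?thesis by simp
  qed
  then show ?thesis
    using gen_binomial_complex[of "- z" "- of_real l"] assms by simp
qed

lemma summable_norm_rise:
  fixes z :: complex
  assumes "norm z < 1" "l \<ge> 0"
  shows "summable (\<lambda>n. norm (of_real (rise l n) * z ^ n))"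
  using rise_sums[of "norm z" l] assms
  by (simp add: norm_mult norm_power rise_nonneg sums_iff)

text \<open>The right half plane avoids the branch cut, so conjugation commutes with
  \<open>powr\<close>.\<close>

lemma powr_mult_cnj:
  assumes "Re w > 0"
  shows "w powr of_real a * cnj w powr of_real a = of_real (((norm w)\<^sup>2) powr a)"
proof -
  have w: "w \<noteq> 0" using assms by auto
  have "norm (w powr of_real a) = norm w powr a"
    using w by (simp add: powr_def)
  moreover have "(norm w powr a)\<^sup>2 = ((norm w)\<^sup>2) powr a"
    by (simp add: power2_eq_square powr_mult)
  moreover have "cnj w powr of_real a = cnj (w powr of_real a)"
    using assms by (simp add: cnj_powr)
  ultimately show ?thesis
    by (simp add: complex_norm_square[symmetric])
qed

text \<open>With \<open>z = s * cis x\<close> the base factors as \<open>(1 - z)(1 - cnj z)\<close>;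
  multiply the two binomial series. Absolute summability is recorded for the later Cauchy
  product.\<close>

lemma gegenbauer_sums:
  fixes s :: real
  assumes s: "\<bar>s\<bar> < 1" and l: "l \<ge> 0"
  shows "(\<lambda>m. s ^ m * gegenbauer_cos l m x) sums (1 - 2 * s * cos x + s\<^sup>2) powr (- l)"
    and "summable (\<lambda>m. \<bar>s ^ m * gegenbauer_cos l m x\<bar>)"
proof -
  define z where "z = of_real s * cis x"
  have z: "norm z < 1" "norm (cnj z) < 1"
    using s by (simp_all add: z_def norm_mult)
  have *: "(\<lambda>m. \<Sum>j\<le>m. (of_real (rise l j) * z ^ j) * (of_real (rise l (m - j)) * cnj z ^ (m - j))) sums
     ((1 - z) powr (- of_real l) * (1 - cnj z) powr (- of_real l))"
    using Cauchy_product_sums[OF summable_norm_rise[OF z(1) l] summable_norm_rise[OF z(2) l]]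
      rise_sums_complex[OF z(1), of l] rise_sums_complex[OF z(2), of l]
    by (simp add: sums_unique[symmetric])
  have "Re z < 1" using z(1) complex_Re_le_cmod[of z] by linarith
  then have "(1 - z) powr (- of_real l) * (1 - cnj z) powr (- of_real l) = of_real (((norm (1 - z))\<^sup>2) powr (- l))"
    using powr_mult_cnj[of "1 - z" "- l"] by simp
  also have "(norm (1 - z))\<^sup>2 = (1 - s * cos x)\<^sup>2 + s\<^sup>2 * (sin x)\<^sup>2"
    by (simp add: cmod_power2 z_def power_mult_distrib)
  also have "\<dots> = 1 - 2 * s * cos x + s\<^sup>2"
    unfolding sin_squared_eq by (simp add: power2_eq_square algebra_simps)
  finally have v: "(1 - z) powr (- of_real l) * (1 - cnj z) powr (- of_real l) =
    of_real ((1 - 2 * s * cos x + s\<^sup>2) powr (- l))" .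
  have re: "Re (\<Sum>j\<le>m. (of_real (rise l j) * z ^ j) * (of_real (rise l (m - j)) * cnj z ^ (m - j))) =
      s ^ m * gegenbauer_cos l m x" for m
    unfolding gegenbauer_cos_def Re_sum sum_distrib_left
  proof (intro sum.cong refl)
    fix j assume j: "j \<in> {..m}"
    have "z ^ j * cnj z ^ (m - j) = of_real (s ^ j * s ^ (m - j)) * (cis (real j * x) * cis (- (real (m - j) * x)))"
      by (simp add: z_def power_mult_distrib cis_cnj Complex.DeMoivre)
    also have "\<dots> = of_real (s ^ m) * cis ((2 * real j - real m) * x)"
      using j by (simp add: cis_mult of_nat_diff algebra_simps flip: power_add of_real_mult)
    finally have e: "z ^ j * cnj z ^ (m - j) = of_real (s ^ m) * cis ((2 * real j - real m) * x)" .
    have e': "(of_real (rise l j) * z ^ j) * (of_real (rise l (m - j)) * cnj z ^ (m - j)) =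
        of_real (rise l j * rise l (m - j)) * (z ^ j * cnj z ^ (m - j))"
      by (simp add: mult_ac)
    show "Re ((of_real (rise l j) * z ^ j) * (of_real (rise l (m - j)) * cnj z ^ (m - j))) =
        s ^ m * (rise l j * rise l (m - j) * cos ((2 * real j - real m) * x))"
      unfolding e' e by simp
  qed
  show "(\<lambda>m. s ^ m * gegenbauer_cos l m x) sums (1 - 2 * s * cos x + s\<^sup>2) powr (- l)"
    using sums_Re[OF *] unfolding re v by simp
  have "summable (\<lambda>m. \<Sum>j\<le>m. norm (of_real (rise l j) * z ^ j) * norm (of_real (rise l (m - j)) * cnj z ^ (m - j)))"
    using Cauchy_product_sums[of "\<lambda>j. norm (of_real (rise l j) * z ^ j)" "\<lambda>j. norm (of_real (rise l j) * cnj z ^ j)"]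
      summable_norm_rise[OF z(1) l] summable_norm_rise[OF z(2) l] by (auto simp: sums_iff)
  then show "summable (\<lambda>m. \<bar>s ^ m * gegenbauer_cos l m x\<bar>)"
  proof (rule summable_comparison_test')
    fix m
    have "\<bar>s ^ m * gegenbauer_cos l m x\<bar> \<le>
        norm (\<Sum>j\<le>m. (of_real (rise l j) * z ^ j) * (of_real (rise l (m - j)) * cnj z ^ (m - j)))"
      unfolding re[symmetric] by (rule abs_Re_le_cmod)
    also have "\<dots> \<le> (\<Sum>j\<le>m. norm ((of_real (rise l j) * z ^ j) * (of_real (rise l (m - j)) * cnj z ^ (m - j))))"
      by (rule norm_sum)
    finally show "norm \<bar>s ^ m * gegenbauer_cos l m x\<bar> \<le>
       (\<Sum>j\<le>m. norm (of_real (rise l j) * z ^ j) * norm (of_real (rise l (m - j)) * cnj z ^ (m - j)))"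
      by (simp only: real_norm_def abs_abs norm_mult)
  qed
qed

text \<open>With \<open>p, q = s exp(+-ix)\<close> one has \<open>2 T_n s^n = p^n + q^n\<close>, a
  pair of geometric series. Summing \<open>V_{n+1} + V_n = 2 T_{n+1}\<close> gives a linear equation
  for the sum \<open>S\<close>, solvable as \<open>1 + s \<noteq> 0\<close>. Complex
  \<open>s\<close> is needed to insert a phase later.\<close>

lemma cheb_V_sums:
  fixes s :: complex
  assumes t: "\<bar>t\<bar> \<le> 1" and s: "norm s < 1"
  shows "(\<lambda>n. of_real (poly (cheb_V n) t) * s ^ n) sums ((1 - s) / (1 - 2 * of_real t * s + s\<^sup>2))"
    and "summable (\<lambda>n. norm (of_real (poly (cheb_V n) t) * s ^ n))"
proof -
  have "summable (\<lambda>n. real (Suc n) * norm s ^ n)"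
    using geometric_deriv_sums[of "norm s"] s by (simp add: sums_iff)
  then have "summable (\<lambda>n. 2 * (real (Suc n) * norm s ^ n))"
    by (rule summable_mult)
  then show sn: "summable (\<lambda>n. norm (of_real (poly (cheb_V n) t) * s ^ n))"
  proof (rule summable_comparison_test')
    fix n
    have "\<bar>poly (cheb_V n) t\<bar> \<le> 2 * real (Suc n)"
      using abs_cheb_V_le[OF t, of n] by simp
    then show "norm (norm (of_real (poly (cheb_V n) t) * s ^ n)) \<le> 2 * (real (Suc n) * norm s ^ n)"
      by (simp add: norm_mult norm_power mult_right_mono flip: mult.assoc)
  qed
  define x where "x = arccos t"
  define p q where "p = s * cis x" and "q = s * cis (- x)"
  have tx: "t = cos x" using t by (simp add: x_def cos_arccos_abs)
  have pq: "norm p < 1" "norm q < 1" using s by (simp_all add: p_def q_def norm_mult)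
  have "p * q = s\<^sup>2 * (cis x * cis (- x))"
    by (simp add: p_def q_def power2_eq_square)
  then have "p * q = s\<^sup>2" by (simp add: cis_mult)
  moreover have "cis x + cis (- x) = 2 * of_real t"
    by (simp add: complex_eq_iff tx)
  then have sum: "p + q = 2 * of_real t * s"
    by (simp add: p_def q_def flip: distrib_left)
  ultimately have den: "(1 - p) * (1 - q) = 1 - 2 * of_real t * s + s\<^sup>2"
    by (simp add: algebra_simps flip: sum)
  have nz: "1 - p \<noteq> 0" "1 - q \<noteq> 0" "1 + s \<noteq> 0"
    using pq s by (auto simp: add_eq_0_iff)
  define C where "C n = complex_of_real (2 * poly (cheb_T n) t) * s ^ n" for n
  have "C = (\<lambda>n. p ^ n + q ^ n)"
  proof
    fix n
    have "p ^ n + q ^ n = s ^ n * (cis (real n * x) + cis (- (real n * x)))"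
      by (simp add: p_def q_def power_mult_distrib Complex.DeMoivre distrib_left)
    also have "cis (real n * x) + cis (- (real n * x)) = 2 * of_real (cos (real n * x))"
      by (simp add: complex_eq_iff)
    finally show "C n = p ^ n + q ^ n" by (simp add: C_def tx cheb_T_cos)
  qed
  then have C: "C sums (1 / (1 - p) + 1 / (1 - q))"
    using sums_add[OF geometric_sums[OF pq(1)] geometric_sums[OF pq(2)]] by simp
  define v where "v n = complex_of_real (poly (cheb_V n) t) * s ^ n" for n
  define S where "S = suminf v"
  have S: "v sums S"
    using summable_norm_cancel[OF sn] by (simp add: S_def v_def[abs_def] summable_sums)
  have "C 0 = 2" by (simp add: C_def)
  with C have "(\<lambda>n. C (Suc n)) sums (1 / (1 - p) + 1 / (1 - q) - 2)"
    by (simp add: sums_Suc_iff)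
  then have "(\<lambda>n. C (Suc n) - s * v n) sums (1 / (1 - p) + 1 / (1 - q) - 2 - s * S)"
    by (intro sums_diff sums_mult S)
  moreover have "C (Suc n) - s * v n = v (Suc n)" for n
    by (simp add: C_def v_def algebra_simps del: cheb_T.simps)
  ultimately have v_Suc: "(\<lambda>n. v (Suc n)) sums (1 / (1 - p) + 1 / (1 - q) - 2 - s * S)"
    by simp
  have "v 0 = 1" by (simp add: v_def)
  then have "(\<lambda>n. v (Suc n)) sums (S - 1)"
    using S by (simp add: sums_Suc_iff)
  then have "S - 1 = 1 / (1 - p) + 1 / (1 - q) - 2 - s * S"
    using v_Suc by (rule sums_unique2)
  then have "(1 + s) * S = 1 / (1 - p) + 1 / (1 - q) - 1"
    by (simp add: algebra_simps)
  also have "\<dots> = (1 - p * q) / ((1 - p) * (1 - q))"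
  proof -
    have "1 / u + 1 / v - 1 = (u + v - u * v) / (u * v)" if "u \<noteq> 0" "v \<noteq> 0" for u v :: complex
      using that by (simp add: field_simps)
    from this[OF nz(1,2)] show ?thesis by (simp add: algebra_simps)
  qed
  also have "\<dots> = (1 + s) * ((1 - s) / (1 - 2 * of_real t * s + s\<^sup>2))"
    unfolding den \<open>p * q = s\<^sup>2\<close> by (simp add: power2_eq_square algebra_simps)
  finally have "S = (1 - s) / (1 - 2 * of_real t * s + s\<^sup>2)"
    using nz(3) by (subst (asm) mult_left_cancel)
  then show "(\<lambda>n. of_real (poly (cheb_V n) t) * s ^ n) sums ((1 - s) / (1 - 2 * of_real t * s + s\<^sup>2))"
    using S by (simp add: v_def[abs_def])
qed

text \<open>The real part of \<open>exp(ix/2)\<close> times the series at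
  \<open>s = r exp(ix)\<close>; \<open>d\<close> is the squared modulus of its denominator. This is
  the kernel for \<open>l = 0\<close>, up to the factor \<open>cos (x / 2)\<close>.\<close>

lemma cheb_V_cos_sums:
  fixes r t x :: real
  assumes t: "\<bar>t\<bar> \<le> 1" and r: "0 \<le> r" "r < 1"
  defines "d \<equiv> (1 + r\<^sup>2) * (1 - 4 * r * cos x * t + r\<^sup>2) + 4 * r\<^sup>2 * (t\<^sup>2 - (sin x)\<^sup>2)"
  shows "(\<lambda>n. r ^ n * cos ((real n + 1 / 2) * x) * poly (cheb_V n) t) sums
     (cos (x / 2) * ((1 - r) * ((1 + r)\<^sup>2 - 2 * r * (cos x + t)) / d))"
    and "summable (\<lambda>n. \<bar>r ^ n * cos ((real n + 1 / 2) * x) * poly (cheb_V n) t\<bar>)"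
proof -
  define s where "s = of_real r * cis x"
  define w where "w = 1 - 2 * of_real t * s + s\<^sup>2"
  have s: "norm s < 1" using r by (simp add: s_def norm_mult)
  have re: "Re (cis (x / 2) * (of_real (poly (cheb_V n) t) * s ^ n)) =
      r ^ n * cos ((real n + 1 / 2) * x) * poly (cheb_V n) t" for n
  proof -
    have "cis (x / 2) * (of_real (poly (cheb_V n) t) * s ^ n) =
      of_real (poly (cheb_V n) t * r ^ n) * (cis (x / 2) * cis (real n * x))"
      by (simp add: s_def power_mult_distrib Complex.DeMoivre mult_ac)
    also have "cis (x / 2) * cis (real n * x) = cis ((real n + 1 / 2) * x)"
      by (simp add: cis_mult algebra_simps)
    finally have e: "cis (x / 2) * (of_real (poly (cheb_V n) t) * s ^ n) =
      of_real (poly (cheb_V n) t * r ^ n) * cis ((real n + 1 / 2) * x)" .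
    show ?thesis unfolding e by simp
  qed
  have "(\<lambda>n. cis (x / 2) * (of_real (poly (cheb_V n) t) * s ^ n)) sums (cis (x / 2) * ((1 - s) / w))"
    unfolding w_def by (intro sums_mult cheb_V_sums t s)
  from sums_Re[OF this] have sums: "(\<lambda>n. r ^ n * cos ((real n + 1 / 2) * x) * poly (cheb_V n) t) sums
      Re (cis (x / 2) * (1 - s) / w)"
    unfolding re by simp
  define c C S where "c = cos (x / 2)" and "C = cos x" and "S = sin x"
  have CS: "S\<^sup>2 = 1 - C\<^sup>2" by (simp add: C_def S_def sin_squared_eq)
  have w: "Re w = 1 - 2 * t * r * cos x + r\<^sup>2 * cos (2 * x)" "Im w = - 2 * t * r * sin x + r\<^sup>2 * sin (2 * x)"
    by (simp_all add: w_def s_def power_mult_distrib Complex.DeMoivre flip: of_real_power)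
  have "(Re w)\<^sup>2 + (Im w)\<^sup>2 = (1 - 2 * t * r * C + r\<^sup>2 * (C\<^sup>2 - S\<^sup>2))\<^sup>2 + S\<^sup>2 * (- 2 * t * r + 2 * r\<^sup>2 * C)\<^sup>2"
    unfolding w cos_double sin_double C_def S_def by (simp add: power2_eq_square algebra_simps)
  also have "\<dots> = d"
    unfolding d_def C_def[symmetric] S_def[symmetric] CS by (simp add: power2_eq_square algebra_simps)
  finally have wd: "(Re w)\<^sup>2 + (Im w)\<^sup>2 = d" .
  define h where "h = x / 2"
  have z: "cis (x / 2) * (1 - s) = cis h - of_real r * cis (3 * h)"
    by (simp add: s_def h_def algebra_simps cis_mult)
  have x: "x = 2 * h" by (simp add: h_def)
  \<comment> \<open>The angles stay unsimplified differences so that \<open>cos_diff\<close>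
    reproduces the products of real and imaginary parts.\<close>
  have "Re (cis (x / 2) * (1 - s)) * Re w + Im (cis (x / 2) * (1 - s)) * Im w =
     cos h - 2 * t * r * cos (2 * h - h) + r\<^sup>2 * cos (4 * h - h) - r * cos (3 * h)
     + 2 * t * r\<^sup>2 * cos (3 * h - 2 * h) - r ^ 3 * cos (4 * h - 3 * h)"
    unfolding z unfolding w cos_diff unfolding x by (simp add: power2_eq_square power3_eq_cube algebra_simps)
  also have "\<dots> = c * (1 - 2 * t * r + 2 * t * r\<^sup>2 - r ^ 3) - r * (1 - r) * cos (3 * h)"
    by (simp add: c_def h_def power2_eq_square algebra_simps)
  also have "cos (3 * h) = c * (2 * C - 1)"
    using cos_add[of "2 * h" h] cos_diff[of "2 * h" h] by (simp add: c_def C_def x algebra_simps)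
  also have "c * (1 - 2 * t * r + 2 * t * r\<^sup>2 - r ^ 3) - r * (1 - r) * (c * (2 * C - 1)) =
      c * ((1 - r) * ((1 + r)\<^sup>2 - 2 * r * (C + t)))"
    by (simp add: power2_eq_square power3_eq_cube algebra_simps)
  finally show "(\<lambda>n. r ^ n * cos ((real n + 1 / 2) * x) * poly (cheb_V n) t) sums
     (cos (x / 2) * ((1 - r) * ((1 + r)\<^sup>2 - 2 * r * (cos x + t)) / d))"
    using sums unfolding Re_divide wd c_def C_def by simp
  show "summable (\<lambda>n. \<bar>r ^ n * cos ((real n + 1 / 2) * x) * poly (cheb_V n) t\<bar>)"
  proof (rule summable_comparison_test'[OF cheb_V_sums(2)[OF t s]])
    fix n
    show "norm \<bar>r ^ n * cos ((real n + 1 / 2) * x) * poly (cheb_V n) t\<bar> \<le> norm (of_real (poly (cheb_V n) t) * s ^ n)"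
      unfolding re[symmetric]
      using abs_Re_le_cmod[of "cis (x / 2) * (of_real (poly (cheb_V n) t) * s ^ n)"]
      by (simp add: norm_mult)
  qed
qed

section \<open>Trigonometric moments of the sieved weight\<close>

lemma abs_powr_mult_self_derivative:
  fixes u a :: real
  assumes "u \<noteq> 0"
  shows "((\<lambda>u. \<bar>u\<bar> powr a * u) has_real_derivative (a + 1) * \<bar>u\<bar> powr a) (at u)"
proof -
  have pos: "((\<lambda>u. \<bar>u\<bar> powr a * u) has_real_derivative (a + 1) * \<bar>u\<bar> powr a) (at u)" if "u > 0" for u :: real
  proof (rule has_field_derivative_transform_within_open[where S = "{0<..}"])
    have "u powr (a - 1) * u = u powr a"
      using that by (simp add: powr_diff)
    then show "((\<lambda>u. u powr a * u) has_real_derivative (a + 1) * \<bar>u\<bar> powr a) (at u)"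
      using that by (auto intro!: derivative_eq_intros simp: algebra_simps)
  qed (use that in auto)
  show ?thesis
  proof (cases "u > 0")
    case False
    then have "((\<lambda>u. \<bar>u\<bar> powr a * u) has_real_derivative (a + 1) * \<bar>u\<bar> powr a) (at (- u))"
      using pos[of "- u"] assms by simp
    then have "((\<lambda>u. - (\<bar>- u\<bar> powr a * (- u))) has_real_derivative - ((a + 1) * \<bar>u\<bar> powr a * (- 1))) (at u)"
      by (intro DERIV_minus DERIV_chain2[where g = uminus]) (auto intro!: derivative_eq_intros)
    then show ?thesis by simp
  qed (rule pos)
qed

text \<open>For \<open>a = 0\<close> the power itself jumps to \<open>0\<close> at
  \<open>u = 0\<close>; the factor \<open>u\<close> hides the jump.\<close>

lemma continuous_abs_powr_mult_self:
  fixes a :: real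
  assumes "a \<ge> 0"
  shows "continuous_on UNIV (\<lambda>u. \<bar>u\<bar> powr a * u)"
proof (cases "a = 0")
  case True
  then have eq: "(\<lambda>u. \<bar>u\<bar> powr a * u) = (\<lambda>u. u)" by auto
  show ?thesis unfolding eq by (rule continuous_on_id)
next
  case False
  then show ?thesis using assms by (intro continuous_intros continuous_on_powr') auto
qed

lemma finite_sin_zeros:
  assumes "k > 0"
  shows "finite {x. 0 \<le> x \<and> x \<le> pi \<and> sin (real k * x) = 0}"
proof (rule finite_subset)
  show "{x. 0 \<le> x \<and> x \<le> pi \<and> sin (real k * x) = 0} \<subseteq> (\<lambda>i. of_int i * pi / real k) ` {0..int k}"
  proof
    fix x
    assume x: "x \<in> {x. 0 \<le> x \<and> x \<le> pi \<and> sin (real k * x) = 0}"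
    then obtain i :: int where i: "real k * x = of_int i * pi"
      by (auto simp: sin_zero_iff_int2)
    have "0 \<le> real k * x" "real k * x \<le> real k * pi"
      using x by (auto intro: mult_left_mono)
    then have "0 \<le> i" "i \<le> int k"
      unfolding i by (simp_all add: zero_le_mult_iff not_le[THEN iffD2, OF pi_gt_zero])
    moreover have "x = of_int i * pi / real k"
      using i assms by (simp add: field_simps)
    ultimately show "x \<in> (\<lambda>i. of_int i * pi / real k) ` {0..int k}" by auto
  qed
qed simp

lemma abs_integrable_sin_powr:
  fixes f :: "real \<Rightarrow> real"
  assumes "continuous_on UNIV f" "l \<ge> 0"
  shows "(\<lambda>x. f x * \<bar>sin (real k * x)\<bar> powr (2 * l)) absolutely_integrable_on {a..b}"
proof (rule measurable_bounded_by_integrable_imp_absolutely_integrable)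
  have [measurable]: "f \<in> borel_measurable borel"
    using assms by (intro borel_measurable_continuous_onI)
  have "(\<lambda>x. f x * \<bar>sin (real k * x)\<bar> powr (2 * l)) \<in> borel_measurable borel"
    by measurable
  then show "(\<lambda>x. f x * \<bar>sin (real k * x)\<bar> powr (2 * l)) \<in> borel_measurable (lebesgue_on {a..b})"
    by (intro measurable_restrict_space1 measurable_completion) simp
  show "(\<lambda>x. \<bar>f x\<bar>) integrable_on {a..b}"
    using assms by (intro integrable_continuous_interval continuous_intros) (auto intro: continuous_on_subset)
  fix x
  have "\<bar>sin (real k * x)\<bar> powr (2 * l) \<le> 1"
    using assms by (intro powr_le1) auto
  then show "norm (f x * \<bar>sin (real k * x)\<bar> powr (2 * l)) \<le> \<bar>f x\<bar>"
    by (simp add: abs_mult mult_left_le)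
qed simp

lemma integrable_sin_powr:
  fixes f :: "real \<Rightarrow> real"
  assumes "continuous_on UNIV f" "l \<ge> 0"
  shows "(\<lambda>x. f x * \<bar>sin (real k * x)\<bar> powr (2 * l)) integrable_on {a..b}"
  using abs_integrable_sin_powr[OF assms] by (rule set_lebesgue_integral_eq_integral(1))

definition sin_moment :: "nat \<Rightarrow> real \<Rightarrow> int \<Rightarrow> real" where
  "sin_moment k l m = integral {0..pi} (\<lambda>x. cos (of_int m * x) * \<bar>sin (real k * x)\<bar> powr (2 * l))"

lemma sin_moment_minus: "sin_moment k l (- m) = sin_moment k l m"
  by (simp add: sin_moment_def)

text \<open>Integration of the derivative of $|\sin kx|^{2l}\sin kx\,\cos((m-k)x)$, which vanishes at $0$ and $\pi$.
  For $l = 0$ this function need not have the stated derivative at the zeros of $\sin kx$, since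
  there $0$ powr $0 = 0$.\<close>

lemma sin_moment_rec:
  assumes k: "k > 0" and l: "l \<ge> 0"
  shows "(2 * l * real k + of_int m) * sin_moment k l m =
    (of_int m - 2 * real k - 2 * l * real k) * sin_moment k l (m - 2 * int k)"
proof -
  define A where "A = 2 * l * real k + of_int m"
  define B where "B = of_int m - 2 * real k - 2 * l * real k"
  let ?W = "\<lambda>x. \<bar>sin (real k * x)\<bar> powr (2 * l)"
  let ?F = "\<lambda>x. (?W x * sin (real k * x)) * cos (of_int (m - int k) * x)"
  let ?f = "\<lambda>x. 1 / 2 * (A * (cos (of_int m * x) * ?W x)) - 1 / 2 * (B * (cos (of_int (m - 2 * int k) * x) * ?W x))"
  have int: "(\<lambda>x. cos (of_int j * x) * ?W x) integrable_on {0..pi}" for j :: int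
    using l by (intro integrable_sin_powr continuous_intros)
  have "(?f has_integral (?F pi - ?F 0)) {0..pi}"
  proof (rule fundamental_theorem_of_calculus_strong[OF finite_sin_zeros[OF k]])
    have "continuous_on UNIV (\<lambda>x. (\<lambda>u. \<bar>u\<bar> powr (2 * l) * u) (sin (real k * x)))"
      by (rule continuous_on_compose2[OF continuous_abs_powr_mult_self]) (use l in \<open>auto intro!: continuous_intros\<close>)
    then have "continuous_on UNIV ?F"
      by (rule continuous_on_mult) (intro continuous_intros)
    then show "continuous_on {0..pi} ?F"
      by (rule continuous_on_subset) simp
    fix x
    assume x: "x \<in> {0..pi} - {x. 0 \<le> x \<and> x \<le> pi \<and> sin (real k * x) = 0}"
    define s t where "s = real k * x" and "t = of_int (m - int k) * x"
    have "((\<lambda>x. sin (real k * x)) has_real_derivative cos s * real k) (at x)"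
      by (auto intro!: derivative_eq_intros simp: s_def)
    moreover have "sin (real k * x) \<noteq> 0" using x by auto
    ultimately have d1: "((\<lambda>x. ?W x * sin (real k * x)) has_real_derivative (2 * l + 1) * ?W x * (cos s * real k)) (at x)"
      using DERIV_chain2[OF abs_powr_mult_self_derivative, of "\<lambda>x. sin (real k * x)" x] by blast
    have d2: "((\<lambda>x. cos (of_int (m - int k) * x)) has_real_derivative - sin t * of_int (m - int k)) (at x)"
      by (auto intro!: derivative_eq_intros simp: t_def)
    have "(?F has_real_derivative ((2 * l + 1) * ?W x * (cos s * real k)) * cos t +
       (- sin t * of_int (m - int k)) * (?W x * sin (real k * x))) (at x)"
      using DERIV_mult[OF d1 d2] by (simp only: t_def)
    \<comment> \<open>Product-to-sum, using \<open>A - B = 2(2l+1)k\<close> and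
      \<open>A + B = 2(m-k)\<close>.\<close>
    moreover have "((2 * l + 1) * ?W x * (cos s * real k)) * cos t +
       (- sin t * of_int (m - int k)) * (?W x * sin (real k * x)) =
       1 / 2 * (A * (cos (t + s) * ?W x)) - 1 / 2 * (B * (cos (t - s) * ?W x))"
      unfolding s_def[symmetric] cos_add cos_diff by (simp add: A_def B_def field_simps)
    moreover have "t + s = of_int m * x" "t - s = of_int (m - 2 * int k) * x"
      by (simp_all add: s_def t_def algebra_simps)
    ultimately show "(?F has_vector_derivative ?f x) (at x)"
      by (simp only: has_real_derivative_iff_has_vector_derivative)
  qed simp
  then have "integral {0..pi} ?f = ?F pi - ?F 0"
    by (rule integral_unique)
  also have "\<dots> = 0" by (simp add: sin_npi)
  finally have "integral {0..pi} ?f = 0" .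
  moreover have "integral {0..pi} ?f = 1 / 2 * (A * sin_moment k l m) - 1 / 2 * (B * sin_moment k l (m - 2 * int k))"
    unfolding sin_moment_def using int
    by (subst integral_diff) (auto intro!: integrable_on_mult_right simp only: integral_mult_right)
  ultimately show ?thesis by (simp add: A_def B_def)
qed

section \<open>Symmetries, vanishing and evaluation of the moments\<close>

lemma integral_reflect_pi:
  fixes f :: "real \<Rightarrow> real"
  shows "integral {0..pi} (\<lambda>x. f (pi - x)) = integral {0..pi} f"
proof -
  have "integral {0..pi} f = integral {-pi..0} (\<lambda>x. f (- x))"
    using Henstock_Kurzweil_Integration.integral_reflect_real[of pi 0 f] by simp
  also have "\<dots> = integral {0..pi} ((\<lambda>x. f (- x)) \<circ> (+) (- pi))"
    using integral_shift_Icc_real[of 0 pi "\<lambda>x. f (- x)" "- pi"] by simp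
  finally show ?thesis by (simp add: o_def)
qed

lemma integral_periodic_shift:
  fixes f :: "real \<Rightarrow> real"
  assumes per: "\<And>x. f (x + c) = f x" and int: "\<And>a b. f integrable_on {a..b}" and h: "0 \<le> h" "h \<le> c"
  shows "integral {0..c} (\<lambda>x. f (x + h)) = integral {0..c} f"
proof -
  have "integral {0..c} (\<lambda>x. f (x + h)) = integral {h..c + h} f"
    using integral_shift_Icc_real[of 0 c f h] by (simp add: o_def add.commute)
  also have "\<dots> = integral {h..c} f + integral {c..c + h} f"
    using h int by (intro Henstock_Kurzweil_Integration.integral_combine[symmetric]) auto
  also have "integral {c..c + h} f = integral {0..h} f"
    using integral_shift_Icc_real[of 0 h f c] per by (simp add: o_def add.commute)
  also have "integral {h..c} f + integral {0..h} f = integral {0..c} f"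
    using h int Henstock_Kurzweil_Integration.integral_combine[of 0 h c f] by simp
  finally show ?thesis .
qed

lemma abs_sin_add_npi: "\<bar>sin (x + real n * pi)\<bar> = \<bar>sin x\<bar>"
  by (simp add: sin_add abs_mult sin_npi cos_npi power_abs)

text \<open>The weight is symmetric about \<open>pi/2\<close> and has period \<open>pi/k\<close>.
  For odd \<open>m\<close> reflection changes the sign of the moment. For even \<open>m\<close>
  reflection kills the sine moment, so a shift by \<open>h = pi/k\<close> multiplies the cosine
  moment by \<open>cos(mh)\<close>, which is \<open>1\<close> only if \<open>2k\<close> divides
  \<open>m\<close>.\<close>

lemma sin_moment_eq_0:
  assumes k: "k > 0" and l: "l \<ge> 0" and m: "\<not> 2 * int k dvd m"
  shows "sin_moment k l m = 0"
proof -
  let ?W = "\<lambda>x. \<bar>sin (real k * x)\<bar> powr (2 * l)"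
  have W_reflect: "?W (pi - x) = ?W x" for x
  proof -
    have "\<bar>sin (real k * (pi - x))\<bar> = \<bar>sin (- (real k * x) + real k * pi)\<bar>"
      by (simp add: algebra_simps)
    then show ?thesis unfolding abs_sin_add_npi by simp
  qed
  have W_shift: "?W (x + real n * pi / real k) = ?W x" for x n
  proof -
    have e: "real k * (x + real n * pi / real k) = real k * x + real n * pi"
      using k by (simp add: distrib_left)
    show ?thesis unfolding e abs_sin_add_npi ..
  qed
  have npi: "cos (of_int m * pi) = (if even m then 1 else - 1)" "sin (of_int m * pi) = 0"
    using cos_npi_int[of m] sin_npi_int[of m] by (simp_all add: mult.commute)
  show ?thesis
  proof (cases "even m")
    case False
    have "cos (of_int m * (pi - x)) = - cos (of_int m * x)" for x
      using False by (simp add: right_diff_distrib cos_diff npi)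
    then have "sin_moment k l m = - sin_moment k l m"
      using integral_reflect_pi[of "\<lambda>x. cos (of_int m * x) * ?W x"]
      unfolding sin_moment_def W_reflect by (simp add: integral_neg)
    then show ?thesis by simp
  next
    case True
    have s: "sin (of_int m * (pi - x)) = - sin (of_int m * x)" for x
      using True by (simp add: right_diff_distrib sin_diff npi)
    let ?S = "integral {0..pi} (\<lambda>x. sin (of_int m * x) * ?W x)"
    have "?S = - ?S"
      using integral_reflect_pi[of "\<lambda>x. sin (of_int m * x) * ?W x"]
      unfolding W_reflect s by (simp add: integral_neg)
    then have S: "?S = 0" by simp
    define h where "h = pi / real k"
    have int: "(\<lambda>x. cos (of_int m * x) * ?W x) integrable_on {a..b}"
      "(\<lambda>x. sin (of_int m * x) * ?W x) integrable_on {a..b}" for a b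
      using l by (intro integrable_sin_powr continuous_intros; simp)+
    have shift: "integral {0..pi} (\<lambda>x. cos (of_int m * (x + h)) * ?W (x + h)) = sin_moment k l m"
      unfolding sin_moment_def
    proof (rule integral_periodic_shift)
      fix x
      have "cos (of_int m * (x + pi)) = cos (of_int m * x)"
        using True by (simp add: distrib_left cos_add npi)
      then show "cos (of_int m * (x + pi)) * ?W (x + pi) = cos (of_int m * x) * ?W x"
        using W_shift[of x k] k by simp
    qed (use k int in \<open>auto simp: h_def field_simps\<close>)
    have expand: "(\<lambda>x. cos (of_int m * (x + h)) * ?W (x + h)) = (\<lambda>x.
      cos (of_int m * h) * (cos (of_int m * x) * ?W x) - sin (of_int m * h) * (sin (of_int m * x) * ?W x))"
    proof
      fix x
      have "?W (x + h) = ?W x"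
        using W_shift[of x 1] by (simp add: h_def)
      then show "cos (of_int m * (x + h)) * ?W (x + h) =
        cos (of_int m * h) * (cos (of_int m * x) * ?W x) - sin (of_int m * h) * (sin (of_int m * x) * ?W x)"
        by (simp only: distrib_left cos_add) (simp add: left_diff_distrib)
    qed
    have "integral {0..pi} (\<lambda>x. cos (of_int m * h) * (cos (of_int m * x) * ?W x) -
        sin (of_int m * h) * (sin (of_int m * x) * ?W x)) = cos (of_int m * h) * sin_moment k l m - sin (of_int m * h) * ?S"
      unfolding sin_moment_def using int
      by (subst integral_diff) (auto intro!: integrable_on_mult_right simp only: integral_mult_right)
    then have "sin_moment k l m = cos (of_int m * h) * sin_moment k l m"
      using shift unfolding expand S by simp
    then have "(1 - cos (of_int m * h)) * sin_moment k l m = 0"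
      by (simp only: left_diff_distrib)
    moreover have "cos (of_int m * h) \<noteq> 1"
    proof
      assume "cos (of_int m * h) = 1"
      then obtain n :: int where "of_int m * h = of_int n * 2 * pi"
        by (auto simp: cos_one_2pi_int)
      then have "real_of_int m = of_int (2 * int k * n)"
        using k by (simp add: h_def field_simps)
      then have "m = 2 * int k * n" by (simp only: of_int_eq_iff)
      then show False using m by simp
    qed
    ultimately show ?thesis by simp
  qed
qed

text \<open>Both sides satisfy the recurrence \<open>(l+n) M_n = (n-1-l) M_{n-1}\<close> and agree
  at \<open>n = 0\<close>. For \<open>n \<ge> 1\<close> the factor \<open>l + n\<close> is positive;
  negative \<open>n\<close> follow by evenness.\<close>

lemma sin_moment_multiple:
  assumes k: "k > 0" and l: "l \<ge> 0"
  shows "sin_moment k l (2 * int k * n) = sin_moment k l 0 * circle_moment l n"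
proof -
  have *: "sin_moment k l (2 * int k * int n) = sin_moment k l 0 * circle_moment l (int n)" for n
  proof (induction n)
    case 0
    show ?case using l by (simp add: circle_moment_0)
  next
    case (Suc n)
    have "2 * int k * int (Suc n) - 2 * int k = 2 * int k * int n" by (simp add: algebra_simps)
    then have "(2 * l * real k + of_int (2 * int k * int (Suc n))) * sin_moment k l (2 * int k * int (Suc n)) =
      (of_int (2 * int k * int (Suc n)) - 2 * real k - 2 * l * real k) * sin_moment k l (2 * int k * int n)"
      using sin_moment_rec[OF k l, of "2 * int k * int (Suc n)"] by (simp only:)
    then have "2 * real k * ((l + real (Suc n)) * sin_moment k l (2 * int k * int (Suc n))) =
      2 * real k * ((real n - l) * sin_moment k l (2 * int k * int n))"
      by (simp add: algebra_simps)
    then have "(l + real (Suc n)) * sin_moment k l (2 * int k * int (Suc n)) =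
      (real n - l) * sin_moment k l (2 * int k * int n)"
      using k by (subst (asm) mult_left_cancel) auto
    also have "\<dots> = sin_moment k l 0 * ((real n - l) * circle_moment l (int n))"
      using Suc by simp
    also have "(real n - l) * circle_moment l (int n) = (l + real (Suc n)) * circle_moment l (int (Suc n))"
      using circle_moment_rec[of l "int (Suc n)"] by simp
    finally have "(l + real (Suc n)) * sin_moment k l (2 * int k * int (Suc n)) =
       (l + real (Suc n)) * (sin_moment k l 0 * circle_moment l (int (Suc n)))"
      by (simp only: mult_ac)
    then show ?case using l by (subst (asm) mult_left_cancel) auto
  qed
  show ?thesis
  proof (cases "n \<ge> 0")
    case True
    then show ?thesis using *[of "nat n"] by simp
  next
    case False
    then show ?thesis
      using *[of "nat (- n)"] circle_moment_minus[of l n] sin_moment_minus[of k l "2 * int k * n"] by simp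
  qed
qed

lemma sin_moment_0_pos:
  assumes k: "k > 0" and l: "l \<ge> 0"
  shows "sin_moment k l 0 > 0"
proof -
  let ?W = "\<lambda>x. \<bar>sin (real k * x)\<bar> powr (2 * l)"
  \<comment> \<open>On this interval \<open>kx\<close> runs through \<open>[pi/6, pi/2]\<close>,
    where the sine is at least \<open>1/2\<close>.\<close>
  define a b where "a = pi / (6 * real k)" and "b = pi / (2 * real k)"
  have ab: "0 < a" "a < b" "b \<le> pi"
    using k by (auto simp: a_def b_def field_simps)
  have W: "(\<lambda>x. 1 * ?W x) integrable_on {u..v}" for u v
    using l by (intro integrable_sin_powr continuous_intros)
  have lower: "(1 / 2) powr (2 * l) \<le> ?W x" if "x \<in> {a..b}" for x
  proof -
    have "pi / 6 \<le> real k * x" "real k * x \<le> pi / 2"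
      using that k by (auto simp: a_def b_def field_simps)
    then have "sin (pi / 6) \<le> sin (real k * x)"
      by (intro sin_monotone_2pi_le) (use pi_gt_zero in linarith)+
    then show ?thesis
      using l by (intro powr_mono2) (auto simp: sin_30)
  qed
  have "0 < (1 / 2) powr (2 * l) * (b - a)" using ab by simp
  also have "\<dots> = integral {a..b} (\<lambda>x. (1 / 2) powr (2 * l))"
    using ab by simp
  also have "\<dots> \<le> integral {a..b} ?W"
    using W lower by (intro integral_le) auto
  also have "\<dots> \<le> integral {0..pi} ?W"
    using W ab by (intro integral_subset_le) auto
  finally show ?thesis by (simp add: sin_moment_def)
qed

section \<open>Orthogonality and the Poisson kernel\<close>

definition sieved_functional :: "nat \<Rightarrow> real \<Rightarrow> real poly \<Rightarrow> real" where
  "sieved_functional k l g =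
     integral {0..pi} (\<lambda>x. poly g (cos x) * (1 + cos x) * \<bar>sin (real k * x)\<bar> powr (2 * l))"

lemma abs_integrable_sieved_functional:
  assumes "l \<ge> 0"
  shows "(\<lambda>x. poly g (cos x) * (1 + cos x) * \<bar>sin (real k * x)\<bar> powr (2 * l)) absolutely_integrable_on {a..b}"
  using assms by (intro abs_integrable_sin_powr continuous_intros)

lemma integrable_sieved_functional:
  assumes "l \<ge> 0"
  shows "(\<lambda>x. poly g (cos x) * (1 + cos x) * \<bar>sin (real k * x)\<bar> powr (2 * l)) integrable_on {a..b}"
  using abs_integrable_sieved_functional[OF assms] by (rule set_lebesgue_integral_eq_integral(1))

lemma sieved_functional_add:
  assumes "l \<ge> 0"
  shows "sieved_functional k l (f + g) = sieved_functional k l f + sieved_functional k l g"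
  unfolding sieved_functional_def
  by (simp only: poly_add distrib_right) (intro integral_add integrable_sieved_functional assms)

lemma sieved_functional_smult:
  "sieved_functional k l (smult c g) = c * sieved_functional k l g"
  by (simp add: sieved_functional_def mult.assoc)

lemma sieved_functional_sum:
  assumes "l \<ge> 0"
  shows "sieved_functional k l (\<Sum>i\<in>A. f i) = (\<Sum>i\<in>A. sieved_functional k l (f i))"
proof -
  have "sieved_functional k l 0 = 0" by (simp add: sieved_functional_def)
  then show ?thesis
    by (induction A rule: infinite_finite_induct) (simp_all add: sieved_functional_add[OF assms])
qed

text \<open>Under \<open>t = cos x\<close> the Jacobian \<open>sin x\<close> and
  \<open>(1-t^2)^(l-1/2)\<close> combine to \<open>(sin x)^(2l)\<close>, which merges with
  \<open>|U_{k-1}|^(2l)\<close> into \<open>|sin kx|^(2l)\<close>. Where \<open>sin x = 0\<close>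
  both integrands vanish.\<close>

lemma weight_integral:
  assumes k: "k > 0" and l: "l \<ge> 0"
  shows "(LBINT x:{-1..1}. poly g x * sieved_weight k l x) = sieved_functional k l g"
proof -
  let ?f = "\<lambda>x. poly g x * sieved_weight k l x"
  let ?g = "\<lambda>x. poly g (cos x) * (1 + cos x) * \<bar>sin (real k * x)\<bar> powr (2 * l)"
  have subst: "\<bar>- sin x\<bar> * ?f (cos x) = ?g x" if "x \<in> {0..pi}" for x
  proof (cases "sin x = 0")
    case True
    then obtain i :: int where "x = of_int i * pi"
      by (auto simp: sin_zero_iff_int2)
    then have "real k * x = of_int (int k * i) * pi" by simp
    then have "sin (real k * x) = 0" by (metis sin_npi_int mult.commute)
    then show ?thesis using True by simp
  next
    case False
    then have s: "sin x > 0" using that sin_ge_zero[of x] by auto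
    have "sin x powr (2 * l) = sin x * (1 - (cos x)\<^sup>2) powr (l - 1 / 2)"
    proof -
      have "(1 - (cos x)\<^sup>2) = sin x powr 2"
        using s by (simp add: sin_squared_eq)
      then have "sin x * (1 - (cos x)\<^sup>2) powr (l - 1 / 2) = sin x powr 1 * sin x powr (2 * (l - 1 / 2))"
        using s by (simp only: powr_powr powr_one less_imp_le)
      also have "\<dots> = sin x powr (2 * l)"
        unfolding powr_add[symmetric] by (simp add: algebra_simps)
      finally show ?thesis ..
    qed
    moreover have "\<bar>sin (real k * x)\<bar> = \<bar>poly (cheb_U (k - 1)) (cos x)\<bar> * sin x"
    proof -
      have "sin (real k * x) = poly (cheb_U (k - 1)) (cos x) * sin x"
        using cheb_U_cos[of "k - 1" x] k by simp
      then show ?thesis using s by (simp add: abs_mult)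
    qed
    ultimately show ?thesis
      using s by (simp add: sieved_weight_def powr_mult)
  qed
  have "(\<lambda>x. \<bar>- sin x\<bar> * ?f (cos x)) absolutely_integrable_on {0..pi}"
    by (rule absolutely_integrable_spike[OF abs_integrable_sieved_functional[OF l, where g = g and k = k] negligible_empty])
      (simp only: Diff_empty subst)
  moreover have "integral {0..pi} (\<lambda>x. \<bar>- sin x\<bar> * ?f (cos x)) = sieved_functional k l g"
    unfolding sieved_functional_def by (rule Henstock_Kurzweil_Integration.integral_cong) (rule subst)
  \<comment> \<open>Change of variables is an equivalence that carries integrability along, so the
    possibly unbounded weight inherits it from the bounded integrand in \<open>x\<close>.\<close>
  ultimately have "(\<lambda>x. \<bar>- sin x\<bar> * ?f (cos x)) absolutely_integrable_on {0..pi} \<and>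
     integral {0..pi} (\<lambda>x. \<bar>- sin x\<bar> * ?f (cos x)) = sieved_functional k l g" ..
  also have "(\<lambda>x. \<bar>- sin x\<bar> * ?f (cos x)) absolutely_integrable_on {0..pi} \<and>
     integral {0..pi} (\<lambda>x. \<bar>- sin x\<bar> * ?f (cos x)) = sieved_functional k l g \<longleftrightarrow>
     ?f absolutely_integrable_on (cos ` {0..pi}) \<and> integral (cos ` {0..pi}) ?f = sieved_functional k l g"
    by (rule has_absolute_integral_change_of_variables_1')
      (auto intro!: derivative_eq_intros inj_onI dest: cos_inj_pi)
  also have "cos ` {0..pi} = {-1..1}"
  proof
    show "{-1..1} \<subseteq> cos ` {0..pi}"
    proof
      fix t :: real
      assume "t \<in> {-1..1}"
      then show "t \<in> cos ` {0..pi}"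
        using arccos_bounded[of t] by (intro image_eqI[of _ _ "arccos t"]) (auto simp: cos_arccos)
    qed
  qed auto
  finally have f: "?f absolutely_integrable_on {-1..1}" "integral {-1..1} ?f = sieved_functional k l g"
    by auto
  \<comment> \<open>The substitution works over \<open>lebesgue\<close>, the weight integral over
    \<open>lborel\<close>; Borel measurability identifies the two.\<close>
  have [measurable]: "poly q \<in> borel_measurable borel" for q :: "real poly"
    by (intro borel_measurable_continuous_onI continuous_intros)
  have "(\<lambda>x. indicator {-1..1} x *\<^sub>R ?f x) \<in> borel_measurable borel"
    unfolding sieved_weight_def by measurable
  then have "(LBINT x:{-1..1}. ?f x) = (LINT x:{-1..1}|lebesgue. ?f x)"
    unfolding set_lebesgue_integral_def by (simp add: integral_completion)
  then show ?thesis
    using set_lebesgue_integral_eq_integral(2)[OF f(1)] f(2) by simp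
qed

lemma weight_inner_sieved:
  assumes "k > 0" "l \<ge> 0"
  shows "weight_inner (sieved_weight k l) p q = sieved_functional k l (p * q) / sieved_functional k l 1"
  using weight_integral[OF assms, of "p * q"] weight_integral[OF assms, of 1]
  by (simp add: weight_inner_def weight_const_def)

text \<open>\<open>1 + cos x = 2 cos^2(x/2)\<close> gives each \<open>V\<close> its half-angle
  factor; the product of the two cosines then splits.\<close>

lemma sieved_functional_cheb_V:
  assumes "l \<ge> 0"
  shows "sieved_functional k l (cheb_V_int i * cheb_V j) =
    sin_moment k l (i - int j) + sin_moment k l (i + int j + 1)"
proof -
  let ?W = "\<lambda>x. \<bar>sin (real k * x)\<bar> powr (2 * l)"
  have int: "(\<lambda>x. cos (of_int m * x) * ?W x) integrable_on {0..pi}" for m :: int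
    using assms by (intro integrable_sin_powr continuous_intros)
  have "poly (cheb_V_int i * cheb_V j) (cos x) * (1 + cos x) =
    cos (of_int (i - int j) * x) + cos (of_int (i + int j + 1) * x)" for x
  proof -
    have "1 + cos x = 2 * (cos (x / 2))\<^sup>2"
      using cos_double_cos[of "x / 2"] by simp
    then have "poly (cheb_V_int i * cheb_V j) (cos x) * (1 + cos x) =
        2 * (poly (cheb_V_int i) (cos x) * cos (x / 2)) * (poly (cheb_V j) (cos x) * cos (x / 2))"
      by (simp add: power2_eq_square)
    also have "\<dots> = cos ((of_int i + 1 / 2) * x - (real j + 1 / 2) * x) + cos ((of_int i + 1 / 2) * x + (real j + 1 / 2) * x)"
      unfolding cheb_V_int_cos cheb_V_cos cos_add cos_diff by simp
    finally show ?thesis by (simp add: algebra_simps)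
  qed
  then have "sieved_functional k l (cheb_V_int i * cheb_V j) =
    integral {0..pi} (\<lambda>x. cos (of_int (i - int j) * x) * ?W x + cos (of_int (i + int j + 1) * x) * ?W x)"
    unfolding sieved_functional_def by (simp only: distrib_right)
  also have "\<dots> = sin_moment k l (i - int j) + sin_moment k l (i + int j + 1)"
    unfolding sin_moment_def using int by (intro integral_add)
  finally show ?thesis .
qed

lemma sieved_functional_1:
  assumes "k > 0" "l \<ge> 0"
  shows "sieved_functional k l 1 = sin_moment k l 0"
proof -
  have "\<not> 2 * int k dvd 1"
    by (metis dvd_mult_left odd_one)
  then show ?thesis
    using sieved_functional_cheb_V[OF assms(2), of k 0 0] sin_moment_eq_0[OF assms, of 1]
    by (simp add: cheb_V_int_def)
qed

text \<open>All frequencies are congruent to \<open>c\<close> modulo \<open>2k\<close>, so the sum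
  vanishes unless \<open>c = -2kx\<close>, when it is a circle moment of the Szego
  polynomial.\<close>

lemma sum_szego_sin_moment:
  assumes k: "k > 0" and l: "l \<ge> 0"
  shows "(\<Sum>i\<le>a. szego_coeff l a i * sin_moment k l (c + 2 * int k * int i)) =
    (if 2 * int k dvd c then sin_moment k l 0 *
      (\<Sum>i\<le>a. szego_coeff l a i * circle_moment l (int i - (- c div (2 * int k)))) else 0)"
proof (cases "2 * int k dvd c")
  case True
  then obtain x where x: "c = 2 * int k * x" by auto
  have "- c div (2 * int k) = - x"
    unfolding x mult_minus_right[symmetric] using k by (subst nonzero_mult_div_cancel_left) auto
  then have "c + 2 * int k * int i = 2 * int k * (int i - (- c div (2 * int k)))" for i
    by (simp add: x algebra_simps)
  then show ?thesis
    using True by (simp only: sin_moment_multiple[OF k l]) (simp add: sum_distrib_left mult_ac)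
next
  case False
  then have "\<not> 2 * int k dvd c + 2 * int k * int i" for i
    by (simp add: dvd_add_left_iff)
  then show ?thesis using False by (simp add: sin_moment_eq_0[OF k l])
qed

text \<open>The extra factor \<open>rise (l + 1)\<close> is the coefficient of \<open>V_n\<close> in
  \<open>Q_n\<close>; it makes \<open>szego_moment_top\<close> applicable without division.\<close>

lemma sieved_functional_sieved_poly:
  assumes k: "k > 0" and l: "l \<ge> 0" and j: "j \<le> n"
  shows "rise (l + 1) (n div k) * sieved_functional k l (sieved_poly k l n * cheb_V j) =
    (if j = n then sin_moment k l 0 * rise (2 * l + 1) (n div k) else 0)"
proof -
  define a b where "a = n div k" and "b = n mod k"
  have n: "int n = int k * int a + int b"
    by (simp add: a_def b_def flip: of_nat_mult of_nat_add)
  have b: "int b < int k" using k by (simp add: b_def)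
  have "sieved_functional k l (sieved_poly k l n * cheb_V j) =
      (\<Sum>i\<le>a. szego_coeff l a i * sieved_functional k l (cheb_V_int (int n - 2 * int k * (int a - int i)) * cheb_V j))"
    by (simp add: sieved_poly_def a_def sum_distrib_right sieved_functional_sum[OF l] sieved_functional_smult)
  also have "\<dots> = (\<Sum>i\<le>a. szego_coeff l a i * sin_moment k l ((int b - int j - int k * int a) + 2 * int k * int i)) +
      (\<Sum>i\<le>a. szego_coeff l a i * sin_moment k l ((int b + int j + 1 - int k * int a) + 2 * int k * int i))"
    unfolding sum.distrib[symmetric] sieved_functional_cheb_V[OF l] n
    by (intro sum.cong refl) (simp add: algebra_simps)
  \<comment> \<open>Here \<open>2kx = ka - b - 1 - j\<close>. As \<open>j \<le> n\<close> and
    \<open>b < k\<close>, this exceeds \<open>-2k\<close>, so the integer \<open>x\<close> is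
    nonnegative; also \<open>2x < a\<close>. The chain vanishes even for
    \<open>j = n\<close>.\<close>
  also have "(\<Sum>i\<le>a. szego_coeff l a i * sin_moment k l ((int b + int j + 1 - int k * int a) + 2 * int k * int i)) = 0"
  proof (cases "2 * int k dvd int b + int j + 1 - int k * int a")
    case True
    then obtain y where y: "int b + int j + 1 - int k * int a = 2 * int k * y" by auto
    define x where "x = - y"
    have x: "int k * (2 * x) = int k * int a - int b - 1 - int j"
      using y by (simp add: x_def)
    then have "int k * (2 * x) > int k * (- 2)" "int k * (2 * x) < int k * int a"
      using j n b by linarith+
    then have "2 * x > - 2" "2 * x < int a"
      using k by (simp_all only: mult_less_cancel_left)
    then have "(\<Sum>i\<le>a. szego_coeff l a i * circle_moment l (int i - x)) = 0"
      using l by (intro szego_moment_eq_0) auto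
    moreover have "- (int b + int j + 1 - int k * int a) div (2 * int k) = x"
      unfolding y x_def mult_minus_right[symmetric] using k by (subst nonzero_mult_div_cancel_left) auto
    ultimately show ?thesis by (simp add: sum_szego_sin_moment[OF k l])
  qed (simp add: sum_szego_sin_moment[OF k l])
  \<comment> \<open>Here \<open>2kx = ka + j - b\<close>, so \<open>x = a\<close> exactly when
    \<open>j = n\<close>. For smaller \<open>j\<close> one gets \<open>a - 1 < 2x < 2a\<close>,
    hence \<open>0 \<le> x < a\<close>.\<close>
  also have "(\<Sum>i\<le>a. szego_coeff l a i * sin_moment k l ((int b - int j - int k * int a) + 2 * int k * int i)) =
      (if j = n then sin_moment k l 0 * (\<Sum>i\<le>a. szego_coeff l a i * circle_moment l (int i - int a)) else 0)"
  proof (cases "2 * int k dvd int b - int j - int k * int a")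
    case True
    then obtain y where y: "int b - int j - int k * int a = 2 * int k * y" by auto
    define x where "x = - y"
    have x: "int k * (2 * x) = int k * int a + int j - int b"
      using y by (simp add: x_def)
    have div: "- (int b - int j - int k * int a) div (2 * int k) = x"
      unfolding y x_def mult_minus_right[symmetric] using k by (subst nonzero_mult_div_cancel_left) auto
    show ?thesis
    proof (cases "j = n")
      case True
      then have "int k * (2 * x) = int k * (2 * int a)"
        using x n by simp
      then have "x = int a" using k by simp
      then show ?thesis using True \<open>2 * int k dvd _\<close> div by (simp add: sum_szego_sin_moment[OF k l])
    next
      case False
      then have lt: "int j < int n" using j by simp
      have two: "int k * (2 * int a) = 2 * (int k * int a)" by simp
      have one: "int k * (int a - 1) = int k * int a - int k" by (simp add: right_diff_distrib)
      have "int k * (2 * x) < int k * (2 * int a)" "int k * (2 * x) > int k * (int a - 1)"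
        using x n b lt two one by linarith+
      then have "2 * x < 2 * int a" "2 * x > int a - 1"
        using k by (simp_all only: mult_less_cancel_left) auto
      then have "(\<Sum>i\<le>a. szego_coeff l a i * circle_moment l (int i - x)) = 0"
        using l by (intro szego_moment_eq_0) auto
      then show ?thesis using False div by (simp add: sum_szego_sin_moment[OF k l])
    qed
  next
    case False
    have "j \<noteq> n"
    proof
      assume "j = n"
      then have e: "int b - int j - int k * int a = 2 * int k * (- int a)" using n by simp
      have "2 * int k dvd int b - int j - int k * int a" unfolding e by (rule dvd_triv_left)
      then show False using False by blast
    qed
    then show ?thesis using False by (simp add: sum_szego_sin_moment[OF k l])
  qed
  finally show ?thesis
    using szego_moment_top[OF l, of a] by (simp add: a_def[symmetric] mult_ac)
qed

text \<open>\<open>Q_n - c V_n\<close> has degree below \<open>n\<close> and is orthogonal to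
  \<open>Q_n\<close>, so one factor may be replaced by \<open>c V_n\<close>.\<close>

lemma sieved_functional_sieved_poly_square:
  assumes k: "k > 0" and l: "l \<ge> 0"
  shows "sieved_functional k l (sieved_poly k l n * sieved_poly k l n) =
    sin_moment k l 0 * rise (2 * l + 1) (n div k)"
proof -
  define c where "c = rise (l + 1) (n div k)"
  have c: "c > 0" using l by (simp add: c_def rise_pos)
  let ?L = "sieved_functional k l" and ?Q = "sieved_poly k l n"
  define D where "D = ?Q - smult c (cheb_V n)"
  have "?L 0 = 0" using sieved_functional_smult[of k l 0 0] by simp
  have D: "coeff D i = 0" if "n \<le> i" for i
    using that k coeff_sieved_poly[of k n i l]
    by (auto simp: D_def c_def coeff_cheb_V coeff_eq_0 degree_cheb_V)
  have "?L (?Q * D) = 0"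
  proof (rule poly_triangular_induct[where V = cheb_V and n = n and \<Phi> = "\<lambda>q. ?L (?Q * q) = 0"])
    show "?L (?Q * cheb_V m) = 0" if "m < n" for m
      using sieved_functional_sieved_poly[OF k l, of m n] that c by (simp add: c_def)
  qed (use D \<open>?L 0 = 0\<close> in \<open>simp_all add: cheb_V_nonzero degree_cheb_V distrib_left
         sieved_functional_add[OF l] sieved_functional_smult\<close>)
  moreover have "?L (?Q * ?Q) = ?L (?Q * D) + c * ?L (?Q * cheb_V n)"
    unfolding sieved_functional_smult[symmetric] sieved_functional_add[OF l, symmetric]
    by (simp add: D_def algebra_simps)
  ultimately show ?thesis
    using sieved_functional_sieved_poly[OF k l, of n n] by (simp add: c_def)
qed

text \<open>At \<open>x = p pi/k\<close> each shift \<open>2k(a-i)x\<close> is a multiple of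
  \<open>2 pi\<close>.\<close>

lemma sieved_poly_cos_multiple:
  fixes p :: nat
  assumes k: "k > 0"
  defines "x \<equiv> real p * pi / real k"
  shows "poly (sieved_poly k l n) (cos x) * cos (x / 2) = rise (2 * l + 1) (n div k) * cos ((real n + 1 / 2) * x)"
proof -
  have "cos ((real n + 1 / 2 - 2 * real k * (real (n div k) - real i)) * x) = cos ((real n + 1 / 2) * x)"
    if "i \<le> n div k" for i
  proof -
    have "(real n + 1 / 2 - 2 * real k * (real (n div k) - real i)) * x =
        (real n + 1 / 2) * x - 2 * real (p * (n div k - i)) * pi"
      using k that by (simp add: x_def of_nat_diff left_diff_distrib field_simps)
    then show ?thesis by (simp only: cos_diff cos_2npi sin_2npi)
  qed
  then show ?thesis
    unfolding sieved_poly_cos sum_szego_coeff[symmetric] sum_distrib_right by simp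
qed

lemma sieved_poly_generating:
  fixes r t :: real and p :: nat
  assumes k: "k > 0" and l: "l \<ge> 0" and t: "\<bar>t\<bar> \<le> 1" and r: "0 \<le> r" "r < 1"
  defines "x \<equiv> real p * pi / real k"
  shows "(\<lambda>n. poly (sieved_poly k l n) t * cos ((real n + 1 / 2) * x) * r ^ n) sums
    ((1 - 2 * (-1) ^ p * r ^ k * poly (cheb_T k) t + r ^ (2 * k)) powr (- l) *
     (cos (x / 2) * ((1 - r) * ((1 + r)\<^sup>2 - 2 * r * (cos x + t)) /
       ((1 + r\<^sup>2) * (1 - 4 * r * cos x * t + r\<^sup>2) + 4 * r\<^sup>2 * (t\<^sup>2 - (sin x)\<^sup>2)))))"
    (is "_ sums (?G * ?H)")
proof -
  define y s where "y = real k * arccos t" and "s = (-1) ^ p * r ^ k"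
  have tcos: "cos (arccos t) = t" using t by (simp add: cos_arccos_abs)
  have s: "\<bar>s\<bar> < 1"
    using r k by (simp add: s_def abs_mult power_abs power_less_one_iff)
  define g where "g m = s ^ m * gegenbauer_cos l m y" for m
  \<comment> \<open>The Gegenbauer series is spread over the multiples of \<open>k\<close>, which
    makes the double sum an ordinary Cauchy product.\<close>
  define A where "A N = (if k dvd N then g (N div k) else 0)" for N
  define B where "B i = r ^ i * cos ((real i + 1 / 2) * x) * poly (cheb_V i) t" for i
  have mono: "strict_mono (\<lambda>m. k * m)" using k by (simp add: strict_mono_def)
  have A0: "A N = 0" if "N \<notin> range (\<lambda>m. k * m)" for N
    using that by (auto simp: A_def elim!: dvdE)
  have Ak: "A (k * m) = g m" for m using k by (simp add: A_def)
  have "poly (cheb_T k) t = cos y"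
    using cheb_T_cos[of k "arccos t"] by (simp add: tcos y_def)
  moreover have "s\<^sup>2 = r ^ (2 * k)"
    by (simp add: s_def power_mult_distrib power_mult mult.commute flip: power_mult)
  ultimately have "?G = (1 - 2 * s * cos y + s\<^sup>2) powr (- l)"
    by (simp add: s_def mult.assoc)
  then have "g sums ?G"
    using gegenbauer_sums(1)[OF s l, of y] by (simp add: g_def[abs_def])
  then have A: "A sums ?G"
    using sums_mono_reindex[of "\<lambda>m. k * m" A ?G] mono A0 by (simp add: Ak)
  have "summable (\<lambda>m. norm (A (k * m)))"
    using gegenbauer_sums(2)[OF s l, of y] by (simp add: Ak g_def)
  then have An: "summable (\<lambda>N. norm (A N))"
    using summable_mono_reindex[of "\<lambda>m. k * m" "\<lambda>N. norm (A N)"] mono A0 by simp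
  have B: "B sums ?H" "summable (\<lambda>i. norm (B i))"
    using cheb_V_cos_sums[OF t r, of x] by (simp_all add: B_def[abs_def])
  have "poly (sieved_poly k l n) t * cos ((real n + 1 / 2) * x) * r ^ n = (\<Sum>N\<le>n. A N * B (n - N))" for n
  proof -
    have le: "k * m \<le> n" if "m \<le> n div k" for m
      using that by (metis le_trans mult_le_mono2 times_div_less_eq_dividend)
    have "(\<Sum>N\<le>n. A N * B (n - N)) = (\<Sum>N\<in>(\<lambda>m. k * m) ` {..n div k}. A N * B (n - N))"
    proof (rule sum.mono_neutral_right)
      show "(\<lambda>m. k * m) ` {..n div k} \<subseteq> {..n}" using le by auto
      show "\<forall>N\<in>{..n} - (\<lambda>m. k * m) ` {..n div k}. A N * B (n - N) = 0"
      proof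
        fix N assume N: "N \<in> {..n} - (\<lambda>m. k * m) ` {..n div k}"
        have "N \<notin> range (\<lambda>m. k * m)"
        proof
          assume "N \<in> range (\<lambda>m. k * m)"
          then obtain m where m: "N = k * m" by auto
          then have "m \<le> n div k"
            using N k by (simp add: less_eq_div_iff_mult_less_eq mult.commute)
          then show False using N m by auto
        qed
        then show "A N * B (n - N) = 0" by (simp add: A0)
      qed
    qed simp
    also have "\<dots> = (\<Sum>m\<le>n div k. g m * B (n - k * m))"
      using k by (subst sum.reindex) (auto simp: inj_on_def Ak)
    also have "\<dots> = (\<Sum>m\<le>n div k. gegenbauer_cos l m y * poly (cheb_V (n - k * m)) t * (cos ((real n + 1 / 2) * x) * r ^ n))"
    proof (intro sum.cong refl)
      fix m assume "m \<in> {..n div k}"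
      then have m: "k * m \<le> n" using le by simp
      \<comment> \<open>Lowering \<open>n\<close> by \<open>km\<close> costs the sign
        \<open>(-1)^(pm)\<close>, which the sign in \<open>s\<close> absorbs.\<close>
      have "(real n + 1 / 2) * x = (real (n - k * m) + 1 / 2) * x + real (p * m) * pi"
        unfolding of_nat_diff[OF m] using k by (simp add: x_def field_simps)
      then have e1: "cos ((real n + 1 / 2) * x) = cos ((real (n - k * m) + 1 / 2) * x) * (-1) ^ (p * m)"
        by (simp only: cos_add cos_npi sin_npi mult_zero_right diff_0_right)
      have e2: "r ^ n = r ^ (k * m) * r ^ (n - k * m)"
        using m by (simp flip: power_add)
      have e3: "s ^ m * ((-1) ^ (p * m)) = r ^ (k * m)"
      proof -
        have "(-1 :: real) ^ p * (-1) ^ p = 1"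
          by (simp flip: power_mult_distrib)
        then have "s * (-1) ^ p = r ^ k"
          by (simp add: s_def mult.commute[of _ "r ^ k"] mult.assoc)
        then have "(s * (-1) ^ p) ^ m = (r ^ k) ^ m" by simp
        then show ?thesis by (simp add: power_mult power_mult_distrib)
      qed
      have e4: "(-1 :: real) ^ (p * m) * (-1) ^ (p * m) = 1"
        by (simp flip: power_mult_distrib)
      have "cos ((real n + 1 / 2) * x) * r ^ n = s ^ m * (r ^ (n - k * m) * cos ((real (n - k * m) + 1 / 2) * x)) *
          ((-1) ^ (p * m) * (-1) ^ (p * m))"
        unfolding e1 e2 e3[symmetric] by (simp only: mult_ac)
      then have e5: "s ^ m * (r ^ (n - k * m) * cos ((real (n - k * m) + 1 / 2) * x)) = cos ((real n + 1 / 2) * x) * r ^ n"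
        unfolding e4 by simp
      have "g m * B (n - k * m) = gegenbauer_cos l m y * poly (cheb_V (n - k * m)) t *
          (s ^ m * (r ^ (n - k * m) * cos ((real (n - k * m) + 1 / 2) * x)))"
        unfolding g_def B_def by (simp only: mult_ac)
      then show "g m * B (n - k * m) =
          gegenbauer_cos l m y * poly (cheb_V (n - k * m)) t * (cos ((real n + 1 / 2) * x) * r ^ n)"
        by (simp only: e5)
    qed
    also have "\<dots> = poly (sieved_poly k l n) t * cos ((real n + 1 / 2) * x) * r ^ n"
    proof -
      have "poly (sieved_gegenbauer k l m) t = gegenbauer_cos l m y" for m
        using sieved_gegenbauer_cos[of k l m "arccos t"] by (simp only: tcos y_def)
      then show ?thesis
        unfolding sieved_poly_convolution[of k l n] by (simp add: poly_sum sum_distrib_right mult.assoc)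
    qed
    finally show ?thesis by (rule sym)
  qed
  then show ?thesis
    using Cauchy_product_sums[OF An B(2)] A B(1) by (simp add: sums_iff)
qed

theorem theorem6p3:
  fixes k p :: nat and l t r :: real
    and P :: "nat \<Rightarrow> real poly" and h :: "nat \<Rightarrow> real"
  assumes "k \<ge> 2" and "l \<ge> 0" and "p \<le> k - 1"
    and "t \<in> {-1..1}" and "0 \<le> r" and "r < 1"
    and "orthogonal_polys (sieved_weight k l) P h"
  shows "summable (\<lambda>n. poly (P n) t * poly (P n) (cos (real p * pi / real k)) / h n * r ^ n) \<and>
    poisson_kernel P h r t (cos (real p * pi / real k)) =
      (1 - r) * ((1 + r)\<^sup>2 - 2 * r * (cos (real p * pi / real k) + t)) /
      (((1 + r\<^sup>2) * (1 - 4 * r * cos (real p * pi / real k) * t + r\<^sup>2)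
          + 4 * r\<^sup>2 * (t\<^sup>2 - (sin (real p * pi / real k))\<^sup>2)) *
       (1 - 2 * (-1) ^ p * r ^ k * poly (cheb_T k) t + r ^ (2 * k)) powr l)"
proof -
  have k: "k > 0" and l: "l \<ge> 0" using assms by auto
  define x where "x = real p * pi / real k"
  define J where "J = sin_moment k l 0"
  have J: "J > 0" using k l by (simp add: J_def sin_moment_0_pos)
  \<comment> \<open>\<open>J\<close> is the total mass of the weight, so \<open>L\<close> carries
    the normalization \<open>weight_const\<close>.\<close>
  define L where "L q = sieved_functional k l q / J" for q
  have QQ: "L (sieved_poly k l n * sieved_poly k l n) = rise (2 * l + 1) (n div k)" for n
    using J by (simp add: L_def sieved_functional_sieved_poly_square[OF k l] flip: J_def)
  have rise: "rise (2 * l + 1) j > 0" for j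
    using l by (intro rise_pos) simp
  have PQ: "poly (P n) u * poly (P n) v / h n =
      poly (sieved_poly k l n) u * poly (sieved_poly k l n) v / L (sieved_poly k l n * sieved_poly k l n)" for n u v
  proof (rule orthogonal_poly_unique[where V = cheb_V and L = L])
    show "L (P n * P m) = (if n = m then h n else 0)" for n m
      using assms(7) by (simp add: orthogonal_polys_def weight_inner_sieved[OF k l] sieved_functional_1[OF k l] L_def J_def)
    show "L (sieved_poly k l n * cheb_V m) = 0" if "m < n" for n m
      using sieved_functional_sieved_poly[OF k l, of m n] that rise_pos[of "l + 1" "n div k"] l
      by (simp add: L_def)
    show "L (sieved_poly k l n * sieved_poly k l n) \<noteq> 0" for n
      using rise[of "n div k"] by (simp add: QQ)
  qed (use assms(7) in \<open>simp_all add: orthogonal_polys_def L_def sieved_functional_add[OF l]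
         sieved_functional_smult add_divide_distrib degree_sieved_poly[OF k l] cheb_V_nonzero degree_cheb_V\<close>)
  \<comment> \<open>The bound \<open>p \<le> k - 1\<close> enters here: it makes
    \<open>cos (x / 2)\<close> positive, hence cancellable.\<close>
  have "x < pi"
    using assms k by (simp add: x_def divide_less_eq)
  moreover have "x \<ge> 0" by (simp add: x_def)
  ultimately have c: "cos (x / 2) > 0"
    by (intro cos_gt_zero_pi) (use pi_gt_zero in linarith)+
  \<comment> \<open>The factor \<open>rise (2 * l + 1) (n div k)\<close> of the value at
    \<open>cos x\<close> is exactly the squared norm and drops out.\<close>
  have term_eq: "poly (P n) t * poly (P n) (cos x) / h n * r ^ n =
      (poly (sieved_poly k l n) t * cos ((real n + 1 / 2) * x) * r ^ n) / cos (x / 2)" for n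
  proof -
    have "poly (sieved_poly k l n) (cos x) = rise (2 * l + 1) (n div k) * cos ((real n + 1 / 2) * x) / cos (x / 2)"
      using sieved_poly_cos_multiple[OF k, of l n p] c by (simp add: x_def field_simps)
    then show ?thesis
      unfolding PQ QQ using rise[of "n div k"] by simp
  qed
  let ?G = "1 - 2 * (-1) ^ p * r ^ k * poly (cheb_T k) t + r ^ (2 * k)"
  let ?N = "(1 - r) * ((1 + r)\<^sup>2 - 2 * r * (cos x + t))"
  let ?D = "(1 + r\<^sup>2) * (1 - 4 * r * cos x * t + r\<^sup>2) + 4 * r\<^sup>2 * (t\<^sup>2 - (sin x)\<^sup>2)"
  have t: "\<bar>t\<bar> \<le> 1" using assms by auto
  have "(\<lambda>n. poly (sieved_poly k l n) t * cos ((real n + 1 / 2) * x) * r ^ n) sums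
     (?G powr (- l) * (cos (x / 2) * (?N / ?D)))"
    using sieved_poly_generating[OF k l t assms(5,6), of p] by (simp only: x_def)
  then have "(\<lambda>n. (poly (sieved_poly k l n) t * cos ((real n + 1 / 2) * x) * r ^ n) / cos (x / 2)) sums
     ((?G powr (- l) * (cos (x / 2) * (?N / ?D))) / cos (x / 2))"
    by (rule sums_divide)
  then have "(\<lambda>n. poly (P n) t * poly (P n) (cos x) / h n * r ^ n) sums
     ((?G powr (- l) * (cos (x / 2) * (?N / ?D))) / cos (x / 2))"
    by (rule sums_cong[OF term_eq, THEN iffD2])
  also have "(?G powr (- l) * (cos (x / 2) * (?N / ?D))) / cos (x / 2) = ?N / (?D * ?G powr l)"
  proof -
    have cancel: "u powr (- l) * (c * (v / w)) / c = v / (w * u powr l)" if "c \<noteq> 0" for u v w c :: real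
      using that by (simp add: powr_minus divide_simps)
    have "cos (x / 2) \<noteq> 0" using c by simp
    then show ?thesis by (rule cancel)
  qed
  finally show ?thesis
    unfolding poisson_kernel_def x_def by (simp add: sums_iff)
qed

end
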